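(* Let $\tilde\delta_n$ be a sequence of random elements of $\mathbb{R}^p$ and let $q_n$ be a sequence of (almost surely twice continuously differentiable) log likelihoods having parameter space $\mathbb{R}^p$ and true parameter value zero. Suppose $$(q_n,\tilde\delta_n)\stackrel{\mathcal{L}}{\longrightarrow}(q,\tilde\delta)\qquad\text{in } C^2(\mathbb{R}^p)\times\mathbb{R}^p,$$ where $q$ is the log likelihood of an LAMN model, $q(\delta)=\delta'Z-\tfrac12\delta'K\delta$, $\delta\in\mathbb{R}^p$, with true parameter value zero and with $K$ almost surely positive definite. Let $G$ be the one-step Newton map and define $\hat\delta_n = G(q_n,\tilde\delta_n)$. Then (a) $-\nabla^2 q_n(\tilde\delta_n)\stackrel{\mathcal{L}}{\longrightarrow}K$; (b) $-\nabla^2 q_n(\hat\delta_n)\stackrel{\mathcal{L}}{\longrightarrow}K$; (c) $\hat\delta_n\stackrel{\mathcal{L}}{\longrightarrow}K^{-1}Z$; (d) $\bigl(-\nabla^2 q_n(\hat\delta_n)\bigr)^{1/2}\hat\delta_n\stackrel{\mathcal{L}}{\longrightarrow}\mathcal{N}(0,I)$, where the matrix square root in (d) is the symmetric square root when the matrix is positive definite and NaO otherwise, and $I$ is the $p\times p$ identity matrix. Moreover, the assumed convergence $(q_n,\tilde\delta_n)\stackrel{\mathcal{L}}{\longrightarrow}(q,\tilde\delta)$ and (a), (b), (c), (d) hold jointly; that is, for some random vector $W\sim\mathcal{N}(0,I)$ defined jointly with $(q,\tilde\delta)$, $$\Bigl(q_n,\tilde\delta_n,-\nabla^2q_n(\tilde\delta_n),-\nabla^2q_n(\hat\delta_n),\hat\delta_n,\bigl(-\nabla^2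 q_n(\hat\delta_n)\bigr)^{1/2}\hat\delta_n\Bigr)\stackrel{\mathcal{L}}{\longrightarrow}\bigl(q,\tilde\delta,K,K,K^{-1}Z,W\bigr).$$
   Context: Convergence in law ($\stackrel{\mathcal{L}}{\longrightarrow}$) of random elements $X_n$ of a Polish space $S$ to a random element $X$ means $E f(X_n)\to E f(X)$ for every bounded continuous $f:S\to\mathbb{R}$; products of Polish spaces carry the product topology. $C^2(\mathbb{R}^p)$ is the Polish space of twice continuously differentiable functions $\mathbb{R}^p\to\mathbb{R}$ with the topology of uniform convergence on compact sets of the functions and their first and second partial derivatives. Log likelihoods: for a parametric model with almost surely positive densities $f_\delta$, $\delta\in\mathbb{R}^p$, with respect to a measure, the log likelihood is the random function $\delta\mapsto u(X)+\log f_\delta(X)$, with $X$ the data and $u$ any function not depending on $\delta$. It is regarded as a random element of $C^2(\mathbb{R}^p)$ whose law is that induced by the true parameter value (here zero). The models for different $n$ need have nothing to do with each other except having the same parameter space. LAMN model: a model whose log likelihood is $q(\delta)=\delta'Z-\tfrac12\delta'K\delta$ (up to an additive term not depending on $\delta$), with $Z$ a random $p$-vector and $K$ a random symmetric $p\times p$ matrix, such that the distribution of $K$ does not depend on the parameter $\delta$ and, for parameter value $\delta$, the conditional distribution of $Z$ given $K$ is $\mathcal{N}(K\delta,K)$. In particular, for true parameter value zero, $Z\mid K\sim\mathcal{N}(0,K)$. NaO ("not an object") is a special value added as an isolated point to a Polish space (giving a Polish space again); it propagates through all operations, i.e. any expression with an argument equal to NaO has value NaO. Quantities that may be NaO are random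 elements of the corresponding Euclidean or matrix space with the isolated point NaO added. One-step Newton map: for $q\in C^2(\mathbb{R}^p)$ and $\delta\in\mathbb{R}^p\cup\{\mathrm{NaO}\}$, $$G(q,\delta)=\delta+\bigl(-\nabla^2q(\delta)\bigr)^{-1}\nabla q(\delta)$$ when $\delta\ne\mathrm{NaO}$ and $-\nabla^2q(\delta)$ is positive definite, and $G(q,\delta)=\mathrm{NaO}$ otherwise. *)

theory Defs
  imports "HOL-Probability.Probability"
begin

definition gradient :: "(real^'p::finite \<Rightarrow> real) \<Rightarrow> real^'p \<Rightarrow> real^'p" where
  "gradient f x = (\<chi> i. frechet_derivative f (at x) (axis i 1))"

definition hessian :: "(real^'p::finite \<Rightarrow> real) \<Rightarrow> real^'p \<Rightarrow> real^'p^'p" where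
  "hessian f x = jacobian (gradient f) (at x)"

definition twice_continuously_differentiable :: "(real^'p::finite \<Rightarrow> real) \<Rightarrow> bool" where
  "twice_continuously_differentiable f \<longleftrightarrow>
     (\<forall>x. f differentiable (at x)) \<and>
     (\<forall>x. gradient f differentiable (at x)) \<and>
     continuous_on UNIV (hessian f)"

lemma gradient_zero: "gradient (\<lambda>_. 0 :: real) = (\<lambda>_. 0)"
  by (simp add: gradient_def fun_eq_iff vec_eq_iff)

lemma twice_continuously_differentiable_zero:
  "twice_continuously_differentiable (\<lambda>_ :: real^'p::finite. 0)"
proof -
  have "hessian (\<lambda>_ :: real^'p. 0) = (\<lambda>_. matrix (\<lambda>_. 0))"
    unfolding fun_eq_iff hessian_def gradient_zero jacobian_def frechet_derivative_const by blast
  then have "continuous_on UNIV (hessian (\<lambda>_ :: real^'p. 0))"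
    by (simp only: continuous_on_const)
  then show ?thesis
    unfolding twice_continuously_differentiable_def gradient_zero by simp
qed

typedef ('p :: finite) c2 = "{f :: real^'p \<Rightarrow> real. twice_continuously_differentiable f}"
  morphisms c2_fun C2
  using twice_continuously_differentiable_zero by blast

abbreviation c2_gradient :: "('p::finite) c2 \<Rightarrow> real^'p \<Rightarrow> real^'p" where
  "c2_gradient q \<equiv> gradient (c2_fun q)"

abbreviation c2_hessian :: "('p::finite) c2 \<Rightarrow> real^'p \<Rightarrow> real^'p^'p" where
  "c2_hessian q \<equiv> hessian (c2_fun q)"

text \<open>The set \<open>c2_nbhd C e q\<close> is a basic neighbourhood of \<open>q\<close> for uniform convergence on
  the compact set \<open>C\<close> of the functions and their first and second partial derivatives.\<close>

definition c2_nbhd :: "(real^'p::finite) set \<Rightarrow> real \<Rightarrow> 'p c2 \<Rightarrow> 'p c2 set" where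
  "c2_nbhd C e q = {r. \<forall>x\<in>C.
     \<bar>c2_fun r x - c2_fun q x\<bar> < e \<and>
     (\<forall>i. \<bar>c2_gradient r x $ i - c2_gradient q x $ i\<bar> < e) \<and>
     (\<forall>i j. \<bar>c2_hessian r x $ i $ j - c2_hessian q x $ i $ j\<bar> < e)}"

lemma c2_nbhd_mono: "C' \<subseteq> C \<Longrightarrow> e \<le> e' \<Longrightarrow> c2_nbhd C e q \<subseteq> c2_nbhd C' e' q"
  unfolding c2_nbhd_def by (force intro: less_le_trans)

instantiation c2 :: (finite) topological_space
begin

definition open_c2 :: "'a c2 set \<Rightarrow> bool" where
  "open_c2 U \<longleftrightarrow> (\<forall>q\<in>U. \<exists>C e. compact C \<and> 0 < e \<and> c2_nbhd C e q \<subseteq> U)"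

instance
proof
  show "open (UNIV :: 'a c2 set)"
    unfolding open_c2_def using compact_empty zero_less_one by blast
next
  fix S T :: "'a c2 set"
  assume S: "open S" and T: "open T"
  show "open (S \<inter> T)"
    unfolding open_c2_def
  proof
    fix q assume "q \<in> S \<inter> T"
    then obtain C e C' e' where
      C: "compact C" "0 < e" "c2_nbhd C e q \<subseteq> S" and
      C': "compact C'" "0 < e'" "c2_nbhd C' e' q \<subseteq> T"
      using S T unfolding open_c2_def by (meson IntD1 IntD2)
    have "c2_nbhd (C \<union> C') (min e e') q \<subseteq> S \<inter> T"
    proof (rule Int_greatest)
      show "c2_nbhd (C \<union> C') (min e e') q \<subseteq> S"
        by (rule order_trans[OF c2_nbhd_mono C(3)]) simp_all
      show "c2_nbhd (C \<union> C') (min e e') q \<subseteq> T"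
        by (rule order_trans[OF c2_nbhd_mono C'(3)]) simp_all
    qed
    moreover have "compact (C \<union> C')" "0 < min e e'"
      using C C' by (simp_all add: compact_Un)
    ultimately show "\<exists>C e. compact C \<and> 0 < e \<and> c2_nbhd C e q \<subseteq> S \<inter> T"
      by blast
  qed
next
  fix \<U> :: "'a c2 set set"
  assume "\<forall>S\<in>\<U>. open S"
  then show "open (\<Union>\<U>)"
    unfolding open_c2_def by (meson Union_iff Sup_upper order_trans)
qed

end

text \<open>\<open>NaO\<close> ("not an object") is an isolated point added to the space \<open>'a\<close>.\<close>

datatype 'a nao = NaO | Obj 'a

instantiation nao :: (topological_space) topological_space
begin

definition open_nao :: "'a nao set \<Rightarrow> bool" where
  "open_nao U \<longleftrightarrow> open (Obj -` U)"

instance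
proof
  show "open (UNIV :: 'a nao set)"
    by (simp add: open_nao_def)
next
  fix S T :: "'a nao set"
  assume "open S" "open T"
  then show "open (S \<inter> T)"
    by (simp add: open_nao_def open_Int)
next
  fix \<U> :: "'a nao set set"
  assume "\<forall>S\<in>\<U>. open S"
  then show "open (\<Union>\<U>)"
    unfolding open_nao_def vimage_Union by blast
qed

end

fun bind_nao :: "('a \<Rightarrow> 'b nao) \<Rightarrow> 'a nao \<Rightarrow> 'b nao" where
  "bind_nao f NaO = NaO"
| "bind_nao f (Obj x) = f x"

definition map2_nao :: "('a \<Rightarrow> 'b \<Rightarrow> 'c) \<Rightarrow> 'a nao \<Rightarrow> 'b nao \<Rightarrow> 'c nao" where
  "map2_nao f a b = bind_nao (\<lambda>x. map_nao (f x) b) a"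

definition pos_semidef :: "real^'p^'p::finite \<Rightarrow> bool" where
  "pos_semidef A \<longleftrightarrow> transpose A = A \<and> (\<forall>x. 0 \<le> x \<bullet> (A *v x))"

definition pos_def :: "real^'p^'p::finite \<Rightarrow> bool" where
  "pos_def A \<longleftrightarrow> transpose A = A \<and> (\<forall>x. x \<noteq> 0 \<longrightarrow> 0 < x \<bullet> (A *v x))"

text \<open>The symmetric square root, meaningful for positive semidefinite matrices.\<close>

definition matrix_sqrt :: "real^'p^'p::finite \<Rightarrow> real^'p^'p" where
  "matrix_sqrt A = (THE B. pos_semidef B \<and> B ** B = A)"

definition pos_def_sqrt :: "real^'p^'p::finite \<Rightarrow> (real^'p^'p) nao" where
  "pos_def_sqrt A = (if pos_def A then Obj (matrix_sqrt A) else NaO)"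

definition newton_step :: "('p::finite) c2 \<Rightarrow> (real^'p) nao \<Rightarrow> (real^'p) nao" where
  "newton_step q = bind_nao (\<lambda>\<delta>.
     if pos_def (- c2_hessian q \<delta>)
     then Obj (\<delta> + matrix_inv (- c2_hessian q \<delta>) *v c2_gradient q \<delta>)
     else NaO)"

text \<open>The \<open>n\<close>-th random element \<open>X n\<close> lives on its own probability space \<open>M n\<close>.
  For a product space, measurability refers to the Borel sets of the product topology; for
  Polish factors this is the same as measurability of the components.\<close>

definition converges_in_law ::
  "(nat \<Rightarrow> 'w measure) \<Rightarrow> (nat \<Rightarrow> 'w \<Rightarrow> 's::topological_space) \<Rightarrow> 'v measure \<Rightarrow> ('v \<Rightarrow> 's) \<Rightarrow> bool"
  where
  "converges_in_law M X N Y \<longleftrightarrow>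
     (\<forall>n. prob_space (M n) \<and> X n \<in> borel_measurable (M n)) \<and>
     prob_space N \<and> Y \<in> borel_measurable N \<and>
     (\<forall>f :: 's \<Rightarrow> real. continuous_on UNIV f \<and> bounded (range f) \<longrightarrow>
        (\<lambda>n. \<integral>\<omega>. f (X n \<omega>) \<partial>M n) \<longlonglongrightarrow> (\<integral>\<omega>. f (Y \<omega>) \<partial>N))"

definition std_mv_normal :: "(real^'p::finite) measure" where
  "std_mv_normal = density lborel (\<lambda>x. ennreal (\<Prod>i\<in>UNIV. std_normal_density (x $ i)))"

text \<open>For a positive semidefinite, possibly singular, variance matrix \<open>S\<close>.\<close>

definition mv_normal :: "real^'p \<Rightarrow> real^'p^'p \<Rightarrow> (real^'p::finite) measure" where
  "mv_normal m S = distr std_mv_normal borel (\<lambda>x. m + matrix_sqrt S *v x)"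

text \<open>Under \<open>P\<close>, the law \<open>\<kappa> (K y)\<close> is a conditional distribution of \<open>Z\<close> given \<open>K\<close>.\<close>

definition has_conditional_law ::
  "'y measure \<Rightarrow> ('y \<Rightarrow> 'z::topological_space) \<Rightarrow> ('y \<Rightarrow> 'k::topological_space) \<Rightarrow>
   ('k \<Rightarrow> 'z measure) \<Rightarrow> bool" where
  "has_conditional_law P Z K \<kappa> \<longleftrightarrow>
     (\<forall>B\<in>sets borel. AE y in P.
        real_cond_exp P (vimage_algebra (space P) K borel) (\<lambda>y. indicator B (Z y)) y
        = measure (\<kappa> (K y)) B)"

text \<open>Densities \<open>f \<delta>\<close> with respect to \<open>\<mu>\<close>; every \<open>f \<delta>\<close> is almost surely positive under
  every distribution in the model.\<close>

definition parametric_model :: "'x measure \<Rightarrow> (real^'p::finite \<Rightarrow> 'x \<Rightarrow> real) \<Rightarrow> bool" where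
  "parametric_model \<mu> f \<longleftrightarrow>
     (\<forall>\<delta>. f \<delta> \<in> borel_measurable \<mu> \<and> (AE x in \<mu>. 0 \<le> f \<delta> x) \<and>
          prob_space (density \<mu> (f \<delta>))) \<and>
     (\<forall>\<delta> \<theta>. AE x in density \<mu> (f \<theta>). 0 < f \<delta> x)"

text \<open>\<open>q\<close> is the log likelihood of the model \<open>(\<mu>, f)\<close> for data \<open>X\<close> defined on \<open>M\<close> and
  distributed according to the parameter value \<open>\<theta>\<close>. On a null set the random function
  \<open>\<delta> \<mapsto> u (X \<omega>) + ln (f \<delta> (X \<omega>))\<close> may fail to be defined or to be twice continuously
  differentiable.\<close>

definition log_likelihood ::
  "real^'p \<Rightarrow> 'w measure \<Rightarrow> ('w \<Rightarrow> 'x) \<Rightarrow> 'x measure \<Rightarrow> (real^'p::finite \<Rightarrow> 'x \<Rightarrow> real) \<Rightarrow>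
   ('w \<Rightarrow> 'p c2) \<Rightarrow> bool" where
  "log_likelihood \<theta> M X \<mu> f q \<longleftrightarrow>
     parametric_model \<mu> f \<and> prob_space M \<and>
     X \<in> measurable M \<mu> \<and> distr M \<mu> X = density \<mu> (f \<theta>) \<and>
     (\<exists>u :: 'x \<Rightarrow> real. AE \<omega> in M. \<forall>\<delta>.
        0 < f \<delta> (X \<omega>) \<and> c2_fun (q \<omega>) \<delta> = u (X \<omega>) + ln (f \<delta> (X \<omega>)))"

text \<open>\<open>Z\<close> and \<open>K\<close> are statistics, i.e. functions of the data.\<close>

definition lamn_model ::
  "'y measure \<Rightarrow> (real^'p::finite \<Rightarrow> 'y \<Rightarrow> real) \<Rightarrow> ('y \<Rightarrow> real^'p) \<Rightarrow> ('y \<Rightarrow> real^'p^'p) \<Rightarrow> bool"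
  where
  "lamn_model \<nu> g Z K \<longleftrightarrow>
     parametric_model \<nu> g \<and> Z \<in> borel_measurable \<nu> \<and> K \<in> borel_measurable \<nu> \<and>
     (\<exists>u :: 'y \<Rightarrow> real. \<forall>\<theta>. AE y in density \<nu> (g \<theta>). \<forall>\<delta>.
        0 < g \<delta> y \<and> u y + ln (g \<delta> y) = \<delta> \<bullet> Z y - (1/2) * (\<delta> \<bullet> (K y *v \<delta>))) \<and>
     (\<forall>\<theta>. AE y in density \<nu> (g \<theta>). pos_semidef (K y)) \<and>
     (\<forall>\<theta> \<theta>'. distr (density \<nu> (g \<theta>)) borel K = distr (density \<nu> (g \<theta>')) borel K) \<and>
     (\<forall>\<theta>. has_conditional_law (density \<nu> (g \<theta>)) Z K (\<lambda>k. mv_normal (k *v \<theta>) k))"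

end

theory Submission
  imports Defs
begin

text \<open>
  The statistics in the theorem form a fixed function \<open>newton_statistics\<close> of the pair
  \<open>(q, \<delta>)\<close>, applied to \<open>(q\<^sub>n, \<delta>\<^sub>n)\<close>, so the theorem is an instance of the continuous mapping
  theorem. For a limit \<open>q\<close> that is quadratic with positive definite \<open>K\<close>, the negative Hessian is
  \<open>K\<close> everywhere and a single Newton step from any point lands on the maximiser \<open>K\<inverse> Z\<close>; this
  identifies all components of the limit. The last one is
  \<open>W = K\<^bsup>1/2\<^esup> K\<inverse> Z\<close>. Since \<open>Z\<close> is conditionally \<open>\<N>(0, K)\<close>, the pair \<open>(K, Z)\<close> is distributed
  like \<open>(K, K\<^bsup>1/2\<^esup> \<xi>)\<close> with \<open>\<xi>\<close> standard normal and independent of \<open>K\<close>, so \<open>W\<close> is distributed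
  like \<open>\<xi>\<close> (\<open>distr_standardize_conditional_normal\<close>).

  The function is not continuous everywhere: it turns into \<open>NaO\<close> where one of the two negative
  Hessians involved stops being positive definite. The space \<open>C\<^sup>2(\<real>\<^sup>p)\<close> is given here as a
  topological space without a chosen metric, so the continuous mapping theorem is proved in a form
  that needs no metric
  (\<open>converges_in_law_continuous_mapping\<close>): it suffices that the function is Borel, and
  continuous on the set where some continuous \<open>d \<ge> 0\<close> is positive, and that the limit lies in this
  set almost surely. The cutoffs \<open>min 1 (k d)\<close> make bounded continuous functions out of bounded
  discontinuous ones, and that they lose little mass is inherited from the limit. The required
  \<open>d\<close>, called \<open>newton_gap\<close>, is built from the distance of the two negative Hessians to the matrices
  whose quadratic form is not positive.

  That positive definiteness is an open condition on \<open>(q, \<delta>)\<close> depends on the symmetry of Hessians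
  (\<open>hessian_symmetric\<close>), because asymmetric matrices are never positive definite. Continuity of the
  normalised estimate needs that the positive semidefinite square root is unique and continuous; both
  follow from one estimate, \<open>\<parallel>B - C\<parallel>\<^sup>2 \<le> \<parallel>B\<^sup>2 - C\<^sup>2\<parallel>\<close> in operator norm for positive
  semidefinite \<open>B\<close> and \<open>C\<close> (\<open>pos_semidef_diff_component_le\<close> is its entrywise form).
\<close>

section \<open>Symmetric matrices and the symmetric square root\<close>

lemma symmetric_matrix_inner:
  fixes A :: "real^'p::finite^'p"
  assumes "transpose A = A"
  shows "x \<bullet> (A *v y) = y \<bullet> (A *v x)"
  by (metis assms dot_lmul_matrix inner_commute transpose_matrix_vector)

text \<open>
  On the unit sphere of an invariant subspace the quadratic form attains its maximum, and the
  maximiser is an eigenvector: otherwise a small step within the subspace would increase the form.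
\<close>

lemma symmetric_matrix_max_eigenvector:
  fixes A :: "real^'p::finite^'p"
  assumes sym: "transpose A = A" and S: "subspace S" "S \<noteq> {0}"
    and inv: "\<And>x. x \<in> S \<Longrightarrow> A *v x \<in> S"
  obtains x l where "x \<in> S" "norm x = 1" "A *v x = l *\<^sub>R x"
    "\<And>y. y \<in> S \<Longrightarrow> y \<bullet> (A *v y) \<le> l * (y \<bullet> y)"
proof -
  have cpt: "compact (sphere 0 1 \<inter> S)"
    by (intro compact_Int_closed closed_subspace S) auto
  obtain s where s: "s \<in> S" "s \<noteq> 0"
    using S subspace_0 by blast
  have "(1 / norm s) *\<^sub>R s \<in> sphere 0 1 \<inter> S"
    using s S by (auto intro: subspace_scale)
  then have ne: "sphere 0 1 \<inter> S \<noteq> {}"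
    by blast
  have "continuous_on (sphere 0 1 \<inter> S) (\<lambda>x. x \<bullet> (A *v x))"
    by (intro continuous_intros)
  from continuous_attains_sup[OF cpt ne this] obtain x where
    x: "x \<in> S" "norm x = 1" and
    max: "\<And>y. y \<in> S \<Longrightarrow> norm y = 1 \<Longrightarrow> y \<bullet> (A *v y) \<le> x \<bullet> (A *v x)"
    by auto
  define l where "l = x \<bullet> (A *v x)"
  have bound: "y \<bullet> (A *v y) \<le> l * (y \<bullet> y)" if "y \<in> S" for y
  proof (cases "y = 0")
    case False
    define z where "z = (1 / norm y) *\<^sub>R y"
    have z: "z \<in> S" "norm z = 1" and y: "y = norm y *\<^sub>R z"
      using False that S by (auto simp: z_def intro: subspace_scale)
    have "y \<bullet> (A *v y) = (norm y)\<^sup>2 * (z \<bullet> (A *v z))"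
      by (subst (1 2) y) (simp add: matrix_vector_mult_scaleR power2_eq_square)
    also have "\<dots> \<le> (norm y)\<^sup>2 * l"
      using max[OF z] by (intro mult_left_mono) (auto simp: l_def)
    finally show ?thesis
      by (simp add: power2_norm_eq_inner mult.commute)
  qed simp
  define w where "w = A *v x - l *\<^sub>R x"
  define h where "h = l * (w \<bullet> w) - w \<bullet> (A *v w)"
  have w: "w \<in> S"
    unfolding w_def using x S inv by (intro subspace_diff subspace_scale) auto
  have h: "0 \<le> h"
    using bound[OF w] by (simp add: h_def)
  have xx: "x \<bullet> x = 1"
    using x by (simp add: norm_eq_1)
  have wAx: "w \<bullet> (A *v x) = w \<bullet> w + l * (w \<bullet> x)"
    by (subst (3) w_def) (simp add: inner_diff_right)
  \<comment> \<open>Moving from the maximiser \<open>x\<close> in the direction \<open>w\<close> would increase the quadratic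
    form to first order by \<open>2 * (w \<bullet> w)\<close>, so \<open>w = 0\<close>.\<close>
  have *: "2 * t * (w \<bullet> w) \<le> t\<^sup>2 * h" for t
  proof -
    have "x + t *\<^sub>R w \<in> S"
      using x w S by (intro subspace_add subspace_scale)
    from bound[OF this] have "0 \<le> l * ((x + t *\<^sub>R w) \<bullet> (x + t *\<^sub>R w))
        - (x + t *\<^sub>R w) \<bullet> (A *v (x + t *\<^sub>R w))"
      by simp
    also have "\<dots> = t\<^sup>2 * h - 2 * t * (w \<bullet> w)"
      by (simp add: inner_add_left inner_add_right matrix_vector_right_distrib xx inner_commute[of x w]
          matrix_vector_mult_scaleR symmetric_matrix_inner[OF sym, of x w] l_def[symmetric] wAx h_def
          distrib_left right_diff_distrib power2_eq_square)
    finally show ?thesis by simp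
  qed
  define t where "t = (w \<bullet> w) / (h + 1)"
  have "w = 0"
  proof (rule ccontr)
    assume "w \<noteq> 0"
    then have t: "0 < t" "t * (h + 1) = w \<bullet> w"
      using h by (auto simp: t_def)
    then have "t * (2 * (w \<bullet> w)) \<le> t * (t * h)"
      using *[of t] by (simp add: power2_eq_square algebra_simps)
    then have "2 * (w \<bullet> w) \<le> t * h"
      using t by simp
    then have "2 * (t * (h + 1)) \<le> t * h"
      using t(2) by simp
    then have "t * h + 2 * t \<le> 0"
      by (simp only: distrib_left mult_1_right)
    moreover have "0 \<le> t * h"
      using h t(1) by simp
    ultimately show False
      using t(1) by linarith
  qed
  then have "A *v x = l *\<^sub>R x"
    by (simp add: w_def)
  then show ?thesis
    using that x bound by blast
qed

text \<open>
  The orthogonal complement of an eigenvector is again invariant, so the spectral theorem follows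
  by induction on the dimension of the invariant subspace.
\<close>

lemma symmetric_matrix_orthonormal_eigenvectors:
  fixes A :: "real^'p::finite^'p"
  assumes sym: "transpose A = A" and "subspace S" and "\<And>x. x \<in> S \<Longrightarrow> A *v x \<in> S"
  obtains B where "pairwise orthogonal B" "\<And>b. b \<in> B \<Longrightarrow> norm b = 1"
    "\<And>b. b \<in> B \<Longrightarrow> A *v b = (b \<bullet> (A *v b)) *\<^sub>R b" "span B = S"
proof -
  have "\<exists>B. pairwise orthogonal B \<and> (\<forall>b\<in>B. norm b = 1 \<and> A *v b = (b \<bullet> (A *v b)) *\<^sub>R b) \<and>
      span B = S"
    using assms(2,3)
  proof (induction "dim S" arbitrary: S rule: less_induct)
    case less
    show ?case
    proof (cases "S = {0}")
      case True
      then show ?thesis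
        by (intro exI[of _ "{}"]) auto
    next
      case False
      then obtain x l where x: "x \<in> S" "norm x = 1" "A *v x = l *\<^sub>R x"
        using symmetric_matrix_max_eigenvector[OF sym less.prems(1) False less.prems(2)] by blast
      define S' where "S' = S \<inter> {y. x \<bullet> y = 0}"
      have xx: "x \<bullet> x = 1"
        using x by (simp add: norm_eq_1)
      have S': "subspace S'"
        unfolding S'_def by (intro subspace_inter less.prems subspace_hyperplane)
      have "x \<notin> S'"
        using xx by (simp add: S'_def)
      then have "S' \<subset> S"
        unfolding S'_def using x(1) by blast
      then have "dim S' < dim S"
        using S' less.prems by (intro dim_psubset) (simp add: span_eq_iff[THEN iffD2])
      moreover have "A *v y \<in> S'" if "y \<in> S'" for y
        using that less.prems symmetric_matrix_inner[OF sym, of x y] x(3)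
        by (auto simp: S'_def inner_commute)
      ultimately obtain B where B: "pairwise orthogonal B"
        "\<forall>b\<in>B. norm b = 1 \<and> A *v b = (b \<bullet> (A *v b)) *\<^sub>R b" "span B = S'"
        using less.hyps[OF _ S'] by blast
      have "B \<subseteq> S'"
        using B span_superset by blast
      then have "pairwise orthogonal (insert x B)"
        using B(1) by (auto simp: pairwise_insert orthogonal_def S'_def inner_commute)
      moreover have "\<forall>b\<in>insert x B. norm b = 1 \<and> A *v b = (b \<bullet> (A *v b)) *\<^sub>R b"
        using B x xx by simp
      moreover have "span (insert x B) = S"
      proof (rule subset_antisym)
        show "span (insert x B) \<subseteq> S"
          using \<open>B \<subseteq> S'\<close> x less.prems by (intro span_minimal) (auto simp: S'_def)
        show "S \<subseteq> span (insert x B)"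
        proof
          fix y assume "y \<in> S"
          then have "y - (x \<bullet> y) *\<^sub>R x \<in> S'"
            using x xx less.prems
            by (auto simp: S'_def inner_diff_right intro!: subspace_diff subspace_scale)
          then show "y \<in> span (insert x B)"
            using B(3) by (auto simp: span_insert)
        qed
      qed
      ultimately show ?thesis
        by blast
    qed
  qed
  then show ?thesis
    using that by blast
qed

lemma pos_semidef_square:
  fixes B :: "real^'p::finite^'p"
  assumes "pos_semidef B"
  shows "pos_semidef (B ** B)"
proof -
  have sym: "transpose B = B"
    using assms by (simp add: pos_semidef_def)
  have "x \<bullet> (B ** B *v x) = (B *v x) \<bullet> (B *v x)" for x
    using symmetric_matrix_inner[OF sym, of x "B *v x"]
    by (simp add: matrix_vector_mul_assoc[symmetric])
  then show ?thesis
    using sym by (simp add: pos_semidef_def matrix_transpose_mul)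
qed

text \<open>
  In an orthonormal basis of eigenvectors, replace every eigenvalue by its square root.
\<close>

lemma pos_semidef_sqrt_exists:
  fixes A :: "real^'p::finite^'p"
  assumes A: "pos_semidef A"
  obtains B where "pos_semidef B" "B ** B = A"
proof -
  have sym: "transpose A = A"
    using A by (simp add: pos_semidef_def)
  obtain E where E: "pairwise orthogonal E" "\<And>b. b \<in> E \<Longrightarrow> norm b = 1"
    "\<And>b. b \<in> E \<Longrightarrow> A *v b = (b \<bullet> (A *v b)) *\<^sub>R b" "span E = UNIV"
    using symmetric_matrix_orthonormal_eigenvectors[OF sym, of UNIV] by auto
  have fin: "finite E"
    using E by (intro pairwise_orthogonal_imp_finite)
  have inner_E: "b \<bullet> c = (if b = c then 1 else 0)" if "b \<in> E" "c \<in> E" for b c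
    using E that by (auto simp: pairwise_def orthogonal_def norm_eq_1)
  define r where "r b = sqrt (b \<bullet> (A *v b))" for b
  have r: "0 \<le> r b" "r b * r b = b \<bullet> (A *v b)" for b
    using A by (auto simp: r_def pos_semidef_def)
  define F where "F v = (\<Sum>b\<in>E. (r b * (b \<bullet> v)) *\<^sub>R b)" for v
  have lin: "linear F"
    unfolding F_def
    by (intro linearI) (simp_all add: inner_add_right algebra_simps sum.distrib scaleR_sum_right)
  then have F: "matrix F *v v = F v" for v
    by (simp add: matrix_works)
  have adj: "x \<bullet> F y = F x \<bullet> y" for x y
    unfolding F_def by (simp add: inner_sum_left inner_sum_right inner_commute mult_ac)
  have "transpose (matrix F) = matrix F"
    using adjoint_unique[of F F] adj matrix_adjoint[OF lin] by (metis inner_commute)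
  moreover have "0 \<le> x \<bullet> (matrix F *v x)" for x
  proof -
    have "x \<bullet> (matrix F *v x) = (\<Sum>b\<in>E. r b * (b \<bullet> x)\<^sup>2)"
      unfolding F unfolding F_def
      by (simp add: inner_sum_right inner_commute[of x] mult.assoc power2_eq_square)
    then show ?thesis
      by (simp add: sum_nonneg r)
  qed
  ultimately have psd: "pos_semidef (matrix F)"
    by (simp add: pos_semidef_def)
  have F_E: "F b = r b *\<^sub>R b" if "b \<in> E" for b
  proof -
    have "F b = (\<Sum>c\<in>E. if c = b then r b *\<^sub>R b else 0)"
      unfolding F_def using that by (intro sum.cong) (auto simp: inner_E)
    then show ?thesis
      using that fin by simp
  qed
  have "(matrix F ** matrix F) *v v = A *v v" for v
  proof (rule linear_eq_on[where f = "(*v) (matrix F ** matrix F)" and g = "(*v) A" and B = E])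
    show "v \<in> span E"
      using E by simp
    fix b assume b: "b \<in> E"
    have "(matrix F ** matrix F) *v b = F (F b)"
      by (simp add: matrix_vector_mul_assoc[symmetric] F)
    also have "\<dots> = A *v b"
      using b by (simp add: F_E linear_scale[OF lin] r(2) E(3)[symmetric])
    finally show "(matrix F ** matrix F) *v b = A *v b" .
  qed simp_all
  then have "matrix F ** matrix F = A"
    by (simp add: matrix_eq)
  with psd that show ?thesis
    by blast
qed

text \<open>
  For a unit eigenvector \<open>x\<close> of \<open>B - C\<close> with eigenvalue \<open>l\<close>, the identity
  \<open>B\<^sup>2 - C\<^sup>2 = B (B - C) + (B - C) C\<close> gives
  \<open>x \<bullet> (B\<^sup>2 - C\<^sup>2) x = l * (x \<bullet> B x + x \<bullet> C x)\<close>, while \<open>l = x \<bullet> B x - x \<bullet> C x\<close> is a difference of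
  nonnegative numbers and so at most their sum in absolute value.
\<close>

lemma pos_semidef_eigenvalue_diff_sq_le:
  fixes B C :: "real^'p::finite^'p"
  assumes B: "pos_semidef B" and C: "pos_semidef C"
    and x: "norm x = 1" "(B - C) *v x = l *\<^sub>R x"
  shows "l\<^sup>2 \<le> onorm ((*v) (B ** B - C ** C))"
proof -
  have sym: "transpose B = B" "transpose C = C"
    and nn: "0 \<le> x \<bullet> (B *v x)" "0 \<le> x \<bullet> (C *v x)"
    using B C by (auto simp: pos_semidef_def)
  have xx: "x \<bullet> x = 1"
    using x by (simp add: norm_eq_1)
  have Bx: "B *v x = C *v x + l *\<^sub>R x"
    using x by (simp add: matrix_vector_mult_diff_rdistrib algebra_simps)
  have l: "l = x \<bullet> (B *v x) - x \<bullet> (C *v x)"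
    unfolding Bx by (simp add: inner_add_right xx)
  have "x \<bullet> ((B ** B - C ** C) *v x) = (B *v x) \<bullet> (B *v x) - (C *v x) \<bullet> (C *v x)"
    using symmetric_matrix_inner[OF sym(1), of x "B *v x"]
      symmetric_matrix_inner[OF sym(2), of x "C *v x"]
    by (simp add: matrix_vector_mult_diff_rdistrib inner_diff_right matrix_vector_mul_assoc)
  also have "\<dots> = l * (x \<bullet> (B *v x) + x \<bullet> (C *v x))"
    unfolding Bx by (simp add: inner_add_left inner_add_right xx algebra_simps inner_commute)
  finally have eq: "x \<bullet> ((B ** B - C ** C) *v x) = l * (x \<bullet> (B *v x) + x \<bullet> (C *v x))" .
  have "\<bar>l\<bar> \<le> \<bar>x \<bullet> (B *v x) + x \<bullet> (C *v x)\<bar>"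
    using nn l by linarith
  then have "\<bar>l\<bar> * \<bar>l\<bar> \<le> \<bar>l\<bar> * \<bar>x \<bullet> (B *v x) + x \<bullet> (C *v x)\<bar>"
    by (rule mult_left_mono) simp
  then have "l\<^sup>2 \<le> \<bar>l * (x \<bullet> (B *v x) + x \<bullet> (C *v x))\<bar>"
    by (simp only: abs_mult power2_eq_square abs_mult_self_eq)
  also have "\<dots> \<le> norm ((B ** B - C ** C) *v x)"
    using Cauchy_Schwarz_ineq2[of x "(B ** B - C ** C) *v x"] x eq by simp
  also have "\<dots> \<le> onorm ((*v) (B ** B - C ** C))"
    using onorm[of "(*v) (B ** B - C ** C)" x] x by simp
  finally show ?thesis .
qed

text \<open>
  The extreme values of the quadratic form of \<open>B - C\<close> are eigenvalues, so the previous estimate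
  bounds all entries of \<open>B - C\<close> by the square root of the distance of the squares. This gives
  uniqueness of the positive semidefinite square root and its continuity at once.
\<close>

lemma pos_semidef_diff_component_le:
  fixes B C :: "real^'p::finite^'p"
  assumes B: "pos_semidef B" and C: "pos_semidef C"
  shows "\<bar>B $ i $ j - C $ i $ j\<bar> \<le> sqrt (\<Sum>i\<in>UNIV. \<Sum>j\<in>UNIV. \<bar>(B ** B) $ i $ j - (C ** C) $ i $ j\<bar>)"
proof -
  have upper: "y \<bullet> ((B - C) *v y) \<le>
      sqrt (\<Sum>i\<in>UNIV. \<Sum>j\<in>UNIV. \<bar>(B ** B) $ i $ j - (C ** C) $ i $ j\<bar>) * (y \<bullet> y)"
    if B: "pos_semidef B" and C: "pos_semidef C" for y and B C :: "real^'p^'p"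
  proof -
    have "transpose (B - C) = B - C"
      using B C by (simp add: pos_semidef_def transpose_def vec_eq_iff)
    moreover have "(UNIV :: (real^'p) set) \<noteq> {0}"
      using UNIV_not_singleton by blast
    ultimately obtain x l where x: "norm x = 1" "(B - C) *v x = l *\<^sub>R x"
      and max: "\<And>y. y \<bullet> ((B - C) *v y) \<le> l * (y \<bullet> y)"
      using symmetric_matrix_max_eigenvector[of "B - C" UNIV] by auto
    have "l\<^sup>2 \<le> onorm ((*v) (B ** B - C ** C))"
      by (rule pos_semidef_eigenvalue_diff_sq_le[OF B C x])
    also have "\<dots> \<le> (\<Sum>i\<in>UNIV. \<Sum>j\<in>UNIV. \<bar>(B ** B - C ** C) $ i $ j\<bar>)"
      by (rule onorm_le_matrix_component_sum)
    finally have "l \<le> sqrt (\<Sum>i\<in>UNIV. \<Sum>j\<in>UNIV. \<bar>(B ** B) $ i $ j - (C ** C) $ i $ j\<bar>)"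
      by (intro real_le_rsqrt) simp
    then show ?thesis
      using max[of y] mult_right_mono[OF _ inner_ge_zero[of y]] by (meson order_trans)
  qed
  let ?s = "sqrt (\<Sum>i\<in>UNIV. \<Sum>j\<in>UNIV. \<bar>(B ** B) $ i $ j - (C ** C) $ i $ j\<bar>)"
  let ?D = "B - C"
  have s: "sqrt (\<Sum>i\<in>UNIV. \<Sum>j\<in>UNIV. \<bar>(C ** C) $ i $ j - (B ** B) $ i $ j\<bar>) = ?s"
    by (simp add: abs_minus_commute)
  have bound: "\<bar>y \<bullet> (?D *v y)\<bar> \<le> ?s * (y \<bullet> y)" for y
    using upper[OF B C, of y] upper[OF C B, of y] unfolding s
    by (simp add: matrix_vector_mult_diff_rdistrib inner_diff_right abs_le_iff)
  have sym: "transpose ?D = ?D"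
    using B C by (simp add: pos_semidef_def transpose_def vec_eq_iff)
  let ?a = "axis i 1 :: real^'p" and ?b = "axis j 1 :: real^'p"
  \<comment> \<open>Polarisation turns the bound on the quadratic form into one on the entries.\<close>
  have "4 * (?a \<bullet> (?D *v ?b)) = (?a + ?b) \<bullet> (?D *v (?a + ?b)) - (?a - ?b) \<bullet> (?D *v (?a - ?b))"
    using symmetric_matrix_inner[OF sym, of ?a ?b]
    by (simp add: inner_add_left inner_add_right inner_diff_left inner_diff_right
        matrix_vector_right_distrib matrix_vector_mult_diff_distrib)
  then have "4 * \<bar>?a \<bullet> (?D *v ?b)\<bar> \<le> ?s * ((?a + ?b) \<bullet> (?a + ?b)) + ?s * ((?a - ?b) \<bullet> (?a - ?b))"
    using bound[of "?a + ?b"] bound[of "?a - ?b"] by linarith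
  also have "\<dots> = ?s * 4"
    by (simp add: inner_add_left inner_add_right inner_diff_left inner_diff_right inner_axis_axis
        inner_commute flip: distrib_left)
  finally have "\<bar>?a \<bullet> (?D *v ?b)\<bar> \<le> ?s"
    by simp
  moreover have "?a \<bullet> (?D *v ?b) = B $ i $ j - C $ i $ j"
    by (simp add: inner_axis' matrix_vector_mul_component inner_axis)
  ultimately show ?thesis
    by simp
qed

lemma pos_semidef_sqrt_unique:
  fixes B C :: "real^'p::finite^'p"
  assumes "pos_semidef B" "pos_semidef C" "B ** B = C ** C"
  shows "B = C"
  using pos_semidef_diff_component_le[OF assms(1,2)] unfolding assms(3) by (simp add: vec_eq_iff)

lemma matrix_sqrt_eqI:
  assumes "pos_semidef B" "B ** B = A"
  shows "matrix_sqrt A = B"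
  unfolding matrix_sqrt_def using assms pos_semidef_sqrt_unique by (blast intro: the_equality)

lemma
  assumes "pos_semidef A"
  shows pos_semidef_matrix_sqrt: "pos_semidef (matrix_sqrt A)"
    and matrix_sqrt_square: "matrix_sqrt A ** matrix_sqrt A = A"
  using pos_semidef_sqrt_exists[OF assms] matrix_sqrt_eqI by metis+

lemma matrix_sqrt_mat_1: "matrix_sqrt (mat 1) = (mat 1 :: real^'p::finite^'p)"
  by (rule matrix_sqrt_eqI) (simp_all add: pos_semidef_def)

lemma continuous_on_matrix_sqrt:
  "continuous_on {A. pos_semidef A} (matrix_sqrt :: real^'p::finite^'p \<Rightarrow> real^'p^'p)"
  unfolding continuous_on_def
proof (intro ballI vec_tendstoI)
  fix A :: "real^'p^'p" and i j
  let ?F = "at A within {A. pos_semidef A}"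
  let ?s = "\<lambda>B :: real^'p^'p. sqrt (\<Sum>i\<in>UNIV. \<Sum>j\<in>UNIV. \<bar>B $ i $ j - A $ i $ j\<bar>)"
  assume "A \<in> {A. pos_semidef A}"
  then have A: "pos_semidef A"
    by simp
  show "((\<lambda>B. matrix_sqrt B $ i $ j) \<longlongrightarrow> matrix_sqrt A $ i $ j) ?F"
  proof (rule Lim_null[THEN iffD2])
    have "continuous_on UNIV ?s"
      by (intro continuous_intros)
    then have "continuous (at A) ?s"
      by (simp add: continuous_on_eq_continuous_at)
    then have "(?s \<longlongrightarrow> ?s A) ?F"
      unfolding isCont_def by (rule tendsto_within_subset) simp
    then have "(?s \<longlongrightarrow> 0) ?F"
      by simp
    moreover have "eventually (\<lambda>B. B \<in> {A. pos_semidef A}) ?F"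
      by (simp add: eventually_at_filter)
    then have "eventually (\<lambda>B. norm (matrix_sqrt B $ i $ j - matrix_sqrt A $ i $ j) \<le> ?s B) ?F"
    proof (rule eventually_mono)
      fix B assume "B \<in> {A :: real^'p^'p. pos_semidef A}"
      then have B: "pos_semidef B"
        by simp
      show "norm (matrix_sqrt B $ i $ j - matrix_sqrt A $ i $ j) \<le> ?s B"
        using pos_semidef_diff_component_le[OF pos_semidef_matrix_sqrt[OF A] pos_semidef_matrix_sqrt[OF B], of i j]
        unfolding matrix_sqrt_square[OF A] matrix_sqrt_square[OF B]
        by (simp only: real_norm_def abs_minus_commute)
    qed
    ultimately show "((\<lambda>B. matrix_sqrt B $ i $ j - matrix_sqrt A $ i $ j) \<longlongrightarrow> 0) ?F"
      by (rule Lim_null_comparison[rotated])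
  qed
qed

lemma closed_pos_semidef: "closed {A :: real^'p::finite^'p. pos_semidef A}"
proof -
  have "{A :: real^'p^'p. pos_semidef A} =
      {A. transpose A = A} \<inter> (\<Inter>x. {A. 0 \<le> x \<bullet> (A *v x)})"
    by (auto simp: pos_semidef_def)
  moreover have "closed {A :: real^'p^'p. transpose A = A}"
    unfolding transpose_def by (intro closed_Collect_eq continuous_intros)
  moreover have "closed {A :: real^'p^'p. 0 \<le> x \<bullet> (A *v x)}" for x
    unfolding matrix_vector_mult_def by (intro closed_Collect_le continuous_intros)
  ultimately show ?thesis
    by (simp add: closed_Int closed_INT)
qed

lemma borel_measurable_matrix_sqrt:
  "(matrix_sqrt :: real^'p::finite^'p \<Rightarrow> real^'p^'p) \<in> borel_measurable borel"
proof -
  \<comment> \<open>A matrix with a positive semidefinite square root is positive semidefinite, so the definite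
    description has one default value on all other matrices.\<close>
  have "matrix_sqrt A = (THE _. False)" if "\<not> pos_semidef A" for A :: "real^'p^'p"
    using that pos_semidef_square unfolding matrix_sqrt_def by (intro arg_cong[where f = The]) auto
  then have "(matrix_sqrt :: real^'p^'p \<Rightarrow> real^'p^'p) =
      (\<lambda>A. if A \<in> {A. pos_semidef A} then matrix_sqrt A else (THE _. False))"
    by (auto simp: fun_eq_iff)
  also have "\<dots> \<in> borel_measurable borel"
    by (intro borel_measurable_continuous_on_if continuous_on_matrix_sqrt borel_closed
        closed_pos_semidef continuous_on_const)
  finally show ?thesis .
qed

section \<open>Inverse matrices and positive definiteness\<close>

lemma
  assumes "invertible A"
  shows matrix_inv_right: "A ** matrix_inv A = mat 1"
    and matrix_inv_left: "matrix_inv A ** A = mat 1"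
  using someI_ex[OF assms[unfolded invertible_def]] by (auto simp: matrix_inv_def)

text \<open>
  By Cramer's rule the solution of a linear system is a quotient of determinants, hence of
  polynomials in the entries.
\<close>

lemma continuous_on_matrix_inv_vector:
  "continuous_on {(A, b :: real^'p::finite). det A \<noteq> 0} (\<lambda>(A, b). matrix_inv A *v b)"
proof -
  have "matrix_inv A *v b = (\<chi> k. det (\<chi> i j. if j = k then b $ i else A $ i $ j) / det A)"
    if "det A \<noteq> 0" for A :: "real^'p^'p" and b
  proof -
    have "A *v (matrix_inv A *v b) = b"
      using that by (simp add: matrix_vector_mul_assoc matrix_inv_right invertible_det_nz)
    then show ?thesis
      using cramer[OF that] by blast
  qed
  then have "continuous_on {(A :: real^'p^'p, b :: real^'p). det A \<noteq> 0} (\<lambda>(A, b). matrix_inv A *v b) \<longleftrightarrow>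
    continuous_on {(A :: real^'p^'p, b :: real^'p). det A \<noteq> 0}
      (\<lambda>x. \<chi> k. det (\<chi> i j. if j = k then snd x $ i else fst x $ i $ j) / det (fst x))"
    by (intro continuous_on_cong) (auto simp only: fst_conv snd_conv)
  moreover have cont_if: "continuous_on T (\<lambda>x. if j = k then snd x $ i else fst x $ i $ j)"
    for T :: "((real^'p^'p) \<times> (real^'p)) set" and i j k
    by (cases "j = k") (auto intro!: continuous_intros)
  have "continuous_on {(A :: real^'p^'p, b :: real^'p). det A \<noteq> 0}
      (\<lambda>x. \<chi> k. det (\<chi> i j. if j = k then snd x $ i else fst x $ i $ j) / det (fst x))"
    unfolding det_def vec_lambda_beta
    by (intro continuous_intros cont_if ballI)
       (auto simp: det_def[symmetric, unfolded of_int_def])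
  ultimately show ?thesis by simp
qed

lemma borel_measurable_matrix_inv_vector:
  "(\<lambda>(A :: real^'p^'p, b :: real^'p::finite). matrix_inv A *v b) \<in> borel_measurable borel"
proof -
  let ?D = "{(A :: real^'p^'p, b :: real^'p). det A \<noteq> 0}"
  have "open ?D"
  proof -
    have "open {x :: (real^'p^'p) \<times> (real^'p). det (fst x) \<noteq> 0}"
      unfolding det_def by (intro open_Collect_neq continuous_intros)
    then show ?thesis
      by (simp add: case_prod_unfold)
  qed
  \<comment> \<open>The inverse of a singular matrix is one default matrix.\<close>
  have "matrix_inv A = (SOME _. False)" if "det A = 0" for A :: "real^'p^'p"
  proof -
    have "\<not> (A ** A' = mat 1 \<and> A' ** A = mat 1)" for A'
      using that invertible_det_nz[of A] unfolding invertible_def by blast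
    then show ?thesis
      unfolding matrix_inv_def by (intro arg_cong[where f = Eps] ext) blast
  qed
  then have "(\<lambda>(A, b :: real^'p). matrix_inv A *v b) =
      (\<lambda>x. if x \<in> ?D then (\<lambda>(A, b). matrix_inv A *v b) x
        else ((SOME _. False) :: real^'p^'p) *v snd x)"
    by (auto simp: fun_eq_iff)
  also have "\<dots> \<in> borel_measurable borel"
    using \<open>open ?D\<close>
    by (intro borel_measurable_continuous_on_if continuous_on_matrix_inv_vector)
       (auto simp: matrix_vector_mult_def intro!: continuous_intros)
  finally show ?thesis .
qed

lemma pos_def_imp_pos_semidef: "pos_def A \<Longrightarrow> pos_semidef A"
  unfolding pos_def_def pos_semidef_def by (metis inner_zero_left less_eq_real_def)

lemma pos_def_invertible:
  fixes A :: "real^'p::finite^'p"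
  assumes "pos_def A"
  shows "invertible A"
proof -
  have "\<forall>x. A *v x = 0 \<longrightarrow> x = 0"
    using assms unfolding pos_def_def by (metis inner_zero_right less_irrefl)
  then show ?thesis
    using matrix_left_invertible_ker invertible_left_inverse by metis
qed

text \<open>
  The condition need only be tested on the unit sphere, and projections along a compact set are
  closed. Symmetry is imposed separately: it is a closed condition, not an open one.
\<close>

lemma open_pos_quadratic_form:
  "open {A :: real^'p::finite^'p. \<forall>x. x \<noteq> 0 \<longrightarrow> 0 < x \<bullet> (A *v x)}"
proof -
  have pos_iff: "(\<forall>x. x \<noteq> 0 \<longrightarrow> 0 < x \<bullet> (A *v x)) \<longleftrightarrow> (\<forall>x\<in>sphere 0 1. 0 < x \<bullet> (A *v x))"
    for A :: "real^'p^'p"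
  proof (intro iffI allI impI ballI)
    fix x :: "real^'p" assume *: "\<forall>x\<in>sphere 0 1. 0 < x \<bullet> (A *v x)" and "x \<noteq> 0"
    then have "0 < ((1 / norm x) *\<^sub>R x) \<bullet> (A *v ((1 / norm x) *\<^sub>R x))"
      by (intro bspec[OF *]) auto
    then show "0 < x \<bullet> (A *v x)"
      using \<open>x \<noteq> 0\<close> by (simp add: matrix_vector_mult_scaleR zero_less_mult_iff zero_less_divide_iff)
  next
    fix x :: "real^'p" assume "\<forall>x. x \<noteq> 0 \<longrightarrow> 0 < x \<bullet> (A *v x)" "x \<in> sphere 0 1"
    then show "0 < x \<bullet> (A *v x)"
      by (metis mem_sphere_0 norm_zero zero_neq_one)
  qed
  have "closed {p :: (real^'p) \<times> (real^'p^'p). fst p \<bullet> (snd p *v fst p) \<le> 0}"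
    unfolding matrix_vector_mult_def by (intro closed_Collect_le continuous_intros)
  then have "closed {A :: real^'p^'p. \<exists>x. x \<in> sphere 0 1 \<and>
      (x, A) \<in> {p. fst p \<bullet> (snd p *v fst p) \<le> 0}}"
    by (intro closed_compact_projection) auto
  moreover have "{A :: real^'p^'p. \<forall>x. x \<noteq> 0 \<longrightarrow> 0 < x \<bullet> (A *v x)} = - {A. \<exists>x. x \<in> sphere 0 1 \<and>
      (x, A) \<in> {p. fst p \<bullet> (snd p *v fst p) \<le> 0}}"
    unfolding pos_iff by (auto simp: not_le) (metis mem_sphere_0 not_le)
  ultimately show ?thesis
    by (simp add: open_Compl)
qed

section \<open>Gradients, Hessians and the symmetry of second derivatives\<close>

lemma has_derivative_gradient:
  assumes "f differentiable (at x)"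
  shows "(f has_derivative (\<lambda>v. gradient f x \<bullet> v)) (at x)"
proof -
  have D: "(f has_derivative frechet_derivative f (at x)) (at x)"
    using assms frechet_derivative_works by blast
  then have lin: "linear (frechet_derivative f (at x))"
    by (rule has_derivative_linear)
  have "frechet_derivative f (at x) v = gradient f x \<bullet> v" for v
  proof -
    have "frechet_derivative f (at x) v = frechet_derivative f (at x) (\<Sum>i\<in>UNIV. v $ i *\<^sub>R axis i 1)"
      by (simp add: basis_expansion flip: scalar_mult_eq_scaleR)
    also have "\<dots> = gradient f x \<bullet> v"
      by (simp add: linear_sum[OF lin] linear_scale[OF lin] gradient_def inner_vec_def mult.commute)
    finally show ?thesis .
  qed
  then have "frechet_derivative f (at x) = (\<lambda>v. gradient f x \<bullet> v)"
    by (rule ext)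
  then show ?thesis
    using D by simp
qed

lemma gradient_eqI:
  assumes "(f has_derivative (\<lambda>v. a \<bullet> v)) (at x)"
  shows "gradient f x = a"
  using fun_cong[OF frechet_derivative_at[OF assms]]
  by (simp add: gradient_def vec_eq_iff inner_axis flip: frechet_derivative_at[OF assms])

lemma has_derivative_hessian:
  assumes "gradient f differentiable (at x)"
  shows "(gradient f has_derivative (\<lambda>v. hessian f x *v v)) (at x)"
  using assms jacobian_works unfolding hessian_def by blast

text \<open>
  The mean value theorem is applied twice: to the increment of \<open>f\<close> in direction \<open>v\<close> as a
  function of the \<open>u\<close> coordinate, then to \<open>u \<bullet> gradient f\<close> along \<open>v\<close>.
\<close>

lemma second_difference_mean_value:
  fixes f :: "real^'p::finite \<Rightarrow> real"
  assumes f: "\<And>x. f differentiable (at x)" and g: "\<And>x. gradient f differentiable (at x)"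
    and h: "0 < h"
  obtains s t where "0 < s" "s < h" "0 < t" "t < h"
    "f (x + h *\<^sub>R u + h *\<^sub>R v) - f (x + h *\<^sub>R u) - f (x + h *\<^sub>R v) + f x =
     h\<^sup>2 * (u \<bullet> (hessian f (x + s *\<^sub>R u + t *\<^sub>R v) *v v))"
proof -
  have f_line: "((\<lambda>s. f (y + s *\<^sub>R u)) has_real_derivative gradient f (y + s *\<^sub>R u) \<bullet> u) (at s)"
    for y s
  proof -
    have "((\<lambda>s. y + s *\<^sub>R u) has_derivative (\<lambda>r. r *\<^sub>R u)) (at s)"
      by (auto intro!: derivative_eq_intros)
    from has_derivative_compose[OF this has_derivative_gradient[OF f]]
    show ?thesis
      by (rule has_derivative_imp_has_field_derivative) simp
  qed
  have g_line: "((\<lambda>t. u \<bullet> gradient f (y + t *\<^sub>R v)) has_real_derivative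
      u \<bullet> (hessian f (y + t *\<^sub>R v) *v v)) (at t)" for y t
  proof -
    have "((\<lambda>t. y + t *\<^sub>R v) has_derivative (\<lambda>r. r *\<^sub>R v)) (at t)"
      by (auto intro!: derivative_eq_intros)
    from has_derivative_inner_right[OF has_derivative_compose[OF this has_derivative_hessian[OF g]]]
    show ?thesis
      by (rule has_derivative_imp_has_field_derivative) (simp add: matrix_vector_mult_scaleR)
  qed
  have "((\<lambda>s. f (x + h *\<^sub>R v + s *\<^sub>R u) - f (x + s *\<^sub>R u)) has_real_derivative
      gradient f (x + h *\<^sub>R v + s *\<^sub>R u) \<bullet> u - gradient f (x + s *\<^sub>R u) \<bullet> u) (at s)" for s
    by (intro derivative_intros f_line)
  from MVT2[OF h this] obtain s where s: "0 < s" "s < h" and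
    1: "f (x + h *\<^sub>R v + h *\<^sub>R u) - f (x + h *\<^sub>R u) - (f (x + h *\<^sub>R v) - f x) =
      h * (gradient f (x + h *\<^sub>R v + s *\<^sub>R u) \<bullet> u - gradient f (x + s *\<^sub>R u) \<bullet> u)"
    by auto
  from MVT2[OF h g_line[of "x + s *\<^sub>R u"]] obtain t where t: "0 < t" "t < h" and
    2: "u \<bullet> gradient f (x + s *\<^sub>R u + h *\<^sub>R v) - u \<bullet> gradient f (x + s *\<^sub>R u) =
      h * (u \<bullet> (hessian f (x + s *\<^sub>R u + t *\<^sub>R v) *v v))"
    by auto
  have "f (x + h *\<^sub>R u + h *\<^sub>R v) - f (x + h *\<^sub>R u) - f (x + h *\<^sub>R v) + f x =
      h * (u \<bullet> gradient f (x + s *\<^sub>R u + h *\<^sub>R v) - u \<bullet> gradient f (x + s *\<^sub>R u))"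
    using 1 by (simp add: inner_commute add_ac)
  also have "\<dots> = h\<^sup>2 * (u \<bullet> (hessian f (x + s *\<^sub>R u + t *\<^sub>R v) *v v))"
    unfolding 2 by (simp add: power2_eq_square)
  finally show ?thesis
    using that s t by blast
qed

lemma second_difference_tendsto:
  fixes f :: "real^'p::finite \<Rightarrow> real"
  assumes "twice_continuously_differentiable f"
  shows "((\<lambda>h. (f (x + h *\<^sub>R u + h *\<^sub>R v) - f (x + h *\<^sub>R u) - f (x + h *\<^sub>R v) + f x) / h\<^sup>2)
    \<longlongrightarrow> u \<bullet> (hessian f x *v v)) (at_right 0)"
proof (rule tendstoI)
  fix e :: real assume e: "0 < e"
  have f: "\<And>x. f differentiable (at x)" and g: "\<And>x. gradient f differentiable (at x)"
    and H: "continuous_on UNIV (hessian f)"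
    using assms by (auto simp: twice_continuously_differentiable_def)
  have "continuous_on UNIV (\<lambda>y. u \<bullet> (hessian f y *v v))"
    unfolding matrix_vector_mult_def by (intro continuous_intros H)
  then obtain d where d: "0 < d"
    "\<And>y. dist y x < d \<Longrightarrow> dist (u \<bullet> (hessian f y *v v)) (u \<bullet> (hessian f x *v v)) < e"
    using e unfolding continuous_on_iff by (metis UNIV_I)
  define d' where "d' = d / (norm u + norm v + 1)"
  have pos: "0 < norm u + norm v + 1"
    by (simp add: add_nonneg_pos)
  then have d': "0 < d'" "d' * (norm u + norm v + 1) = d"
    using d by (auto simp: d'_def)
  show "eventually (\<lambda>h. dist ((f (x + h *\<^sub>R u + h *\<^sub>R v) - f (x + h *\<^sub>R u) - f (x + h *\<^sub>R v) + f x) / h\<^sup>2)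
    (u \<bullet> (hessian f x *v v)) < e) (at_right 0)"
    unfolding eventually_at_right_field
  proof (intro exI conjI allI impI)
    show "0 < d'" by fact
    fix h assume h: "0 < h" "h < d'"
    obtain s t where st: "0 < s" "s < h" "0 < t" "t < h"
      "f (x + h *\<^sub>R u + h *\<^sub>R v) - f (x + h *\<^sub>R u) - f (x + h *\<^sub>R v) + f x =
        h\<^sup>2 * (u \<bullet> (hessian f (x + s *\<^sub>R u + t *\<^sub>R v) *v v))"
      using second_difference_mean_value[OF f g h(1)] by blast
    have "dist (x + s *\<^sub>R u + t *\<^sub>R v) x = norm (s *\<^sub>R u + t *\<^sub>R v)"
      by (simp add: dist_norm add.assoc)
    also have "\<dots> \<le> s * norm u + t * norm v"
      using st norm_triangle_ineq[of "s *\<^sub>R u" "t *\<^sub>R v"] by simp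
    also have "\<dots> \<le> d' * norm u + d' * norm v"
      using st h by (intro add_mono mult_right_mono) auto
    also have "\<dots> < d' * (norm u + norm v + 1)"
      using d' by (simp add: distrib_left)
    finally have "dist (u \<bullet> (hessian f (x + s *\<^sub>R u + t *\<^sub>R v) *v v)) (u \<bullet> (hessian f x *v v)) < e"
      using d d'(2) by simp
    then show "dist ((f (x + h *\<^sub>R u + h *\<^sub>R v) - f (x + h *\<^sub>R u) - f (x + h *\<^sub>R v) + f x) / h\<^sup>2)
      (u \<bullet> (hessian f x *v v)) < e"
      unfolding st(5) using h by simp
  qed
qed

text \<open>
  The second difference is symmetric in the two directions, and so is its limit.
\<close>

lemma hessian_symmetric:
  fixes f :: "real^'p::finite \<Rightarrow> real"
  assumes "twice_continuously_differentiable f"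
  shows "transpose (hessian f x) = hessian f x"
proof -
  have sym: "u \<bullet> (hessian f x *v v) = v \<bullet> (hessian f x *v u)" for u v
  proof (rule tendsto_unique)
    show "((\<lambda>h. (f (x + h *\<^sub>R u + h *\<^sub>R v) - f (x + h *\<^sub>R u) - f (x + h *\<^sub>R v) + f x) / h\<^sup>2)
        \<longlongrightarrow> u \<bullet> (hessian f x *v v)) (at_right 0)"
      by (rule second_difference_tendsto[OF assms])
    show "((\<lambda>h. (f (x + h *\<^sub>R u + h *\<^sub>R v) - f (x + h *\<^sub>R u) - f (x + h *\<^sub>R v) + f x) / h\<^sup>2)
        \<longlongrightarrow> v \<bullet> (hessian f x *v u)) (at_right 0)"
      using second_difference_tendsto[OF assms, of x v u] by (simp add: add_ac algebra_simps)
  qed simp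
  have "hessian f x $ i $ j = hessian f x $ j $ i" for i j
    using sym[of "axis i 1" "axis j 1"]
    by (simp add: inner_axis' matrix_vector_mul_component inner_axis)
  then show ?thesis
    by (simp add: transpose_def vec_eq_iff)
qed

lemma
  fixes K :: "real^'p::finite^'p"
  assumes f: "\<And>x. f x = x \<bullet> z - (1/2) * (x \<bullet> (K *v x))" and K: "transpose K = K"
  shows gradient_quadratic: "gradient f x = z - K *v x"
    and hessian_quadratic: "hessian f x = - K"
proof -
  note sym = symmetric_matrix_inner[OF K]
  have K_deriv: "((*v) K has_derivative (*v) K) (at x)" for x
    by (intro bounded_linear_imp_has_derivative) simp
  have "((\<lambda>x. x \<bullet> z - (1/2) * (x \<bullet> (K *v x))) has_derivative (\<lambda>v. (z - K *v x) \<bullet> v)) (at x)" for x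
    by (rule derivative_eq_intros K_deriv refl)+
       (simp add: fun_eq_iff inner_diff_left inner_commute[of "K *v x"] sym[of x] inner_commute[of z])
  then show grad: "gradient f x = z - K *v x" for x
    using gradient_eqI f by (metis (no_types, lifting) ext)
  have "gradient f = (\<lambda>x. z - K *v x)"
    by (rule ext) (rule grad)
  moreover have "((\<lambda>x. z - K *v x) has_derivative (\<lambda>v. - (K *v v))) (at x)"
    by (rule derivative_eq_intros K_deriv refl)+ simp
  ultimately have "frechet_derivative (gradient f) (at x) = (\<lambda>v. - (K *v v))"
    using frechet_derivative_at by metis
  also have "\<dots> = (*v) (- K)"
    by (simp add: fun_eq_iff matrix_vector_mult_def vec_eq_iff sum_negf)
  finally show "hessian f x = - K"
    by (simp add: hessian_def jacobian_def)
qed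

section \<open>The topology of twice continuously differentiable functions\<close>

lemma twice_continuously_differentiable_c2_fun: "twice_continuously_differentiable (c2_fun q)"
  using c2_fun by blast

text \<open>
  The sets \<open>c2_nbhd C e q\<close> are neighbourhoods of \<open>q\<close> in the topology that they generate, which
  is what allows estimates with them to be turned into limits.
\<close>

lemma eventually_c2_nbhd:
  assumes "compact C" "0 < e"
  shows "eventually (\<lambda>r. r \<in> c2_nbhd C e q) (nhds q)"
proof -
  define U where "U = {r. \<exists>e'<e. r \<in> c2_nbhd C e' q}"
  \<comment> \<open>There is room for a smaller neighbourhood around every \<open>r\<close> that is strictly inside.\<close>
  have "open U"
    unfolding open_c2_def
  proof
    fix r assume "r \<in> U"
    then obtain e' where e': "e' < e" "r \<in> c2_nbhd C e' q"
      by (auto simp: U_def)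
    define d where "d = (e - e') / 2"
    have d: "0 < d" "e' + d < e"
      using e' by (auto simp: d_def field_simps)
    have tri: "\<bar>a - b\<bar> < d \<Longrightarrow> \<bar>b - c\<bar> < e' \<Longrightarrow> \<bar>a - c\<bar> < e' + d" for a b c :: real
      by linarith
    have "c2_nbhd C d r \<subseteq> c2_nbhd C (e' + d) q"
      using e'(2) unfolding c2_nbhd_def by (blast intro: tri)
    then show "\<exists>C e. compact C \<and> 0 < e \<and> c2_nbhd C e r \<subseteq> U"
      using assms(1) d unfolding U_def by blast
  qed
  moreover have "q \<in> U"
    unfolding U_def c2_nbhd_def using assms by (auto intro!: exI[of _ "e / 2"])
  moreover have "U \<subseteq> c2_nbhd C e q"
    unfolding U_def using c2_nbhd_mono[OF order_refl less_imp_le] by blast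
  ultimately show ?thesis
    unfolding eventually_nhds by blast
qed

text \<open>
  Joint continuity of evaluation: near \<open>(q, x)\<close>, compare \<open>F r y\<close> with \<open>F q y\<close> uniformly for \<open>y\<close> in a
  compact ball about \<open>x\<close>, and then \<open>F q y\<close> with \<open>F q x\<close>.
\<close>

lemma continuous_on_c2_eval:
  fixes F :: "('p::finite) c2 \<Rightarrow> real^'p \<Rightarrow> real"
  assumes cont: "\<And>q. continuous_on UNIV (F q)"
    and near: "\<And>C e q r x. r \<in> c2_nbhd C e q \<Longrightarrow> x \<in> C \<Longrightarrow> \<bar>F r x - F q x\<bar> < e"
  shows "continuous_on UNIV (\<lambda>p. F (fst p) (snd p))"
proof -
  have "((\<lambda>p. F (fst p) (snd p)) \<longlongrightarrow> F q x) (nhds (q, x))" for q x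
  proof (rule tendstoI)
    fix e :: real assume "0 < e"
    then have e: "0 < e / 2"
      by simp
    have "(F q \<longlongrightarrow> F q x) (nhds x)"
      using cont[of q] by (simp add: continuous_on_eq_continuous_at isCont_def tendsto_nhds_iff)
    then have "eventually (\<lambda>y. dist (F q y) (F q x) < e / 2 \<and> y \<in> cball x 1) (nhds x)"
      using e by (intro eventually_conj tendstoD eventually_nhds_in_nhd) auto
    moreover have "eventually (\<lambda>r. r \<in> c2_nbhd (cball x 1) (e / 2) q) (nhds q)"
      using e by (intro eventually_c2_nbhd) auto
    ultimately have "eventually (\<lambda>p. fst p \<in> c2_nbhd (cball x 1) (e / 2) q \<and>
        dist (F q (snd p)) (F q x) < e / 2 \<and> snd p \<in> cball x 1) (nhds (q, x))"
      unfolding nhds_prod eventually_prod_filter by fastforce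
    then show "eventually (\<lambda>p. dist (F (fst p) (snd p)) (F q x) < e) (nhds (q, x))"
    proof (rule eventually_mono)
      fix p assume *: "fst p \<in> c2_nbhd (cball x 1) (e / 2) q \<and>
        dist (F q (snd p)) (F q x) < e / 2 \<and> snd p \<in> cball x 1"
      then have "\<bar>F (fst p) (snd p) - F q (snd p)\<bar> < e / 2"
        using near by blast
      with * show "dist (F (fst p) (snd p)) (F q x) < e"
        unfolding dist_real_def by linarith
    qed
  qed
  then show ?thesis
    unfolding continuous_on_def by (auto intro: tendsto_mono[OF at_within_le_nhds])
qed

lemma continuous_on_c2_gradient:
  "continuous_on UNIV (\<lambda>p :: ('p::finite) c2 \<times> (real^'p). c2_gradient (fst p) (snd p))"
proof -
  have "continuous_on UNIV (c2_gradient q)" for q :: "'p c2"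
    using twice_continuously_differentiable_c2_fun[of q]
    unfolding twice_continuously_differentiable_def
    by (intro differentiable_imp_continuous_on) (auto simp: differentiable_on_def)
  then have "continuous_on UNIV (\<lambda>p :: 'p c2 \<times> (real^'p). c2_gradient (fst p) (snd p) $ i)" for i
    by (intro continuous_on_c2_eval continuous_intros) (auto simp: c2_nbhd_def)
  then have "continuous_on UNIV (\<lambda>p :: 'p c2 \<times> (real^'p). \<chi> i. c2_gradient (fst p) (snd p) $ i)"
    by (intro continuous_on_vec_lambda)
  then show ?thesis
    by simp
qed

lemma continuous_on_c2_hessian:
  "continuous_on UNIV (\<lambda>p :: ('p::finite) c2 \<times> (real^'p). c2_hessian (fst p) (snd p))"
proof -
  have "continuous_on UNIV (c2_hessian q)" for q :: "'p c2"
    using twice_continuously_differentiable_c2_fun[of q]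
    unfolding twice_continuously_differentiable_def by blast
  then have "continuous_on UNIV (\<lambda>p :: 'p c2 \<times> (real^'p). c2_hessian (fst p) (snd p) $ i $ j)" for i j
    by (intro continuous_on_c2_eval continuous_intros) (auto simp: c2_nbhd_def)
  then have "continuous_on UNIV (\<lambda>p :: 'p c2 \<times> (real^'p). \<chi> i j. c2_hessian (fst p) (snd p) $ i $ j)"
    by (intro continuous_on_vec_lambda)
  then show ?thesis
    by simp
qed

section \<open>Convergence in law under discontinuous mappings\<close>

text \<open>
  Where \<open>u\<close> vanishes, \<open>v\<close> is squeezed to zero. Functions that are only known to be continuous on
  an open set \<open>{x. 0 < u x}\<close> become continuous everywhere after multiplication by a cutoff.
\<close>

lemma continuous_on_dominated_by_vanishing:
  fixes u v :: "'a::topological_space \<Rightarrow> real"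
  assumes u: "continuous_on UNIV u" and le: "\<And>x. \<bar>v x\<bar> \<le> u x" and v: "continuous_on {x. 0 < u x} v"
  shows "continuous_on UNIV v"
proof -
  have "(v \<longlongrightarrow> v x) (at x)" for x
  proof (cases "0 < u x")
    case True
    have "open {x. 0 < u x}"
      by (intro open_Collect_less u continuous_on_const)
    then have "at x within {x. 0 < u x} = at x"
      using True by (intro at_within_open) auto
    then show ?thesis
      using v True unfolding continuous_on_def by fastforce
  next
    case False
    then have "u x = 0" "v x = 0"
      using le[of x] by auto
    have "(u \<longlongrightarrow> 0) (at x)"
      using u \<open>u x = 0\<close> unfolding continuous_on_def by (metis UNIV_I)
    then have "(v \<longlongrightarrow> 0) (at x)"
      by (rule Lim_null_comparison[rotated]) (simp add: le)
    then show ?thesis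
      by (simp add: \<open>v x = 0\<close>)
  qed
  then show ?thesis
    by (simp add: continuous_on_def)
qed

lemma converges_in_law_measurable:
  assumes "converges_in_law M X N Y"
  shows "prob_space (M n)" "X n \<in> borel_measurable (M n)" "prob_space N" "Y \<in> borel_measurable N"
  using assms by (auto simp: converges_in_law_def)

lemma converges_in_law_integral:
  fixes f :: "'s::topological_space \<Rightarrow> real"
  assumes "converges_in_law M X N Y" "continuous_on UNIV f" "\<And>x. \<bar>f x\<bar> \<le> B"
  shows "(\<lambda>n. \<integral>\<omega>. f (X n \<omega>) \<partial>M n) \<longlonglongrightarrow> (\<integral>\<omega>. f (Y \<omega>) \<partial>N)"
proof -
  have "bounded (range f)"
    using assms(3) by (auto simp: bounded_iff)
  then show ?thesis
    using assms by (auto simp: converges_in_law_def)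
qed

lemma converges_in_law_continuous_image:
  fixes h :: "'s::topological_space \<Rightarrow> 't::topological_space"
  assumes conv: "converges_in_law M X N Y" and h: "continuous_on UNIV h"
  shows "converges_in_law M (\<lambda>n \<omega>. h (X n \<omega>)) N (\<lambda>\<omega>. h (Y \<omega>))"
proof -
  have meas: "h \<in> borel_measurable borel"
    using h by (rule borel_measurable_continuous_onI)
  show ?thesis
    unfolding converges_in_law_def
  proof (intro conjI allI impI)
    fix f :: "'t \<Rightarrow> real" assume f: "continuous_on UNIV f \<and> bounded (range f)"
    then obtain B where B: "\<And>x. \<bar>f x\<bar> \<le> B"
      by (auto simp: bounded_iff)
    have "continuous_on UNIV (f \<circ> h)"
      using f by (intro continuous_on_compose[OF h]) (auto intro: continuous_on_subset)
    from converges_in_law_integral[OF conv this, of B] B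
    show "(\<lambda>n. \<integral>\<omega>. f (h (X n \<omega>)) \<partial>M n) \<longlonglongrightarrow> (\<integral>\<omega>. f (h (Y \<omega>)) \<partial>N)"
      by simp
  qed (use converges_in_law_measurable[OF conv] measurable_compose[OF _ meas] in auto)
qed

lemma (in prob_space) integrable_bounded_comp:
  fixes f :: "'s::topological_space \<Rightarrow> real"
  assumes "X \<in> borel_measurable M" "f \<in> borel_measurable borel" "\<And>x. \<bar>f x\<bar> \<le> B"
  shows "integrable M (\<lambda>\<omega>. f (X \<omega>))"
  using assms(3) measurable_compose[OF assms(1,2)] by (intro integrable_const_bound[of _ B]) auto

text \<open>
  Discarding the part of \<open>F\<close> removed by the cutoff \<open>c\<close> costs at most the bound of \<open>F\<close> times the
  expected loss of mass. For continuous \<open>c\<close> that loss converges under convergence in law.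
\<close>

lemma (in prob_space) cutoff_error_le:
  fixes F c :: "'s::topological_space \<Rightarrow> real"
  assumes X: "X \<in> borel_measurable M" and F: "F \<in> borel_measurable borel" and c: "c \<in> borel_measurable borel"
    and FB: "\<And>x. \<bar>F x\<bar> \<le> B" and c01: "\<And>x. 0 \<le> c x" "\<And>x. c x \<le> 1"
  shows "\<bar>(\<integral>\<omega>. F (X \<omega>) \<partial>M) - (\<integral>\<omega>. c (X \<omega>) * F (X \<omega>) \<partial>M)\<bar> \<le> B * (1 - (\<integral>\<omega>. c (X \<omega>) \<partial>M))"
proof -
  have c1: "\<bar>c x\<bar> \<le> 1" for x
    using c01[of x] by simp
  have cFB: "\<bar>c x * F x\<bar> \<le> 1 * B" for x
    unfolding abs_mult using c1 FB by (intro mult_mono) auto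
  have int: "integrable M (\<lambda>\<omega>. F (X \<omega>))" "integrable M (\<lambda>\<omega>. c (X \<omega>))"
    using integrable_bounded_comp[OF X F FB] integrable_bounded_comp[OF X c c1] by auto
  have int': "integrable M (\<lambda>\<omega>. c (X \<omega>) * F (X \<omega>))"
    using integrable_bounded_comp[OF X borel_measurable_times[OF c F] cFB] by auto
  have "\<bar>(\<integral>\<omega>. F (X \<omega>) \<partial>M) - (\<integral>\<omega>. c (X \<omega>) * F (X \<omega>) \<partial>M)\<bar> =
      \<bar>\<integral>\<omega>. F (X \<omega>) - c (X \<omega>) * F (X \<omega>) \<partial>M\<bar>"
    using int int' by simp
  also have "\<dots> \<le> (\<integral>\<omega>. \<bar>F (X \<omega>) - c (X \<omega>) * F (X \<omega>)\<bar> \<partial>M)"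
    by (rule integral_abs_bound)
  also have "\<dots> \<le> (\<integral>\<omega>. B * (1 - c (X \<omega>)) \<partial>M)"
  proof (rule integral_mono)
    fix \<omega>
    have "F (X \<omega>) - c (X \<omega>) * F (X \<omega>) = F (X \<omega>) * (1 - c (X \<omega>))"
      by (simp add: right_diff_distrib)
    then have "\<bar>F (X \<omega>) - c (X \<omega>) * F (X \<omega>)\<bar> = \<bar>F (X \<omega>)\<bar> * (1 - c (X \<omega>))"
      using c01(2)[of "X \<omega>"] by (simp add: abs_mult)
    also have "\<dots> \<le> B * (1 - c (X \<omega>))"
      using FB c01(2) by (intro mult_right_mono) auto
    finally show "\<bar>F (X \<omega>) - c (X \<omega>) * F (X \<omega>)\<bar> \<le> B * (1 - c (X \<omega>))" .
  qed (use int int' in auto)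
  also have "\<dots> = B * (1 - (\<integral>\<omega>. c (X \<omega>) \<partial>M))"
    using int by (simp add: prob_space)
  finally show ?thesis .
qed

text \<open>
  A continuous mapping theorem for arbitrary topological spaces, in which the exceptional set of
  the mapping is the zero set of a continuous function \<open>d\<close>. For the cutoffs \<open>c k = min 1 (k d)\<close>, the
  functions \<open>c k\<close> and \<open>c k * (f \<circ> h)\<close> are continuous and bounded, so their expectations converge. The
  error of the cutoff is controlled by the mass lost by \<open>c k\<close>, which is small for the limit once \<open>k\<close>
  is large, and hence also along the sequence. The limit is allowed to differ from \<open>h \<circ> Y\<close> on a null
  set.
\<close>

lemma converges_in_law_continuous_mapping:
  fixes h :: "'s::topological_space \<Rightarrow> 't::topological_space" and d :: "'s \<Rightarrow> real"
  assumes conv: "converges_in_law M X N Y"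
    and d: "continuous_on UNIV d" "\<And>x. 0 \<le> d x" and d_pos: "AE \<omega> in N. 0 < d (Y \<omega>)"
    and h: "h \<in> borel_measurable borel" "continuous_on {x. 0 < d x} h"
    and Y': "Y' \<in> borel_measurable N" "AE \<omega> in N. Y' \<omega> = h (Y \<omega>)"
  shows "converges_in_law M (\<lambda>n \<omega>. h (X n \<omega>)) N Y'"
  unfolding converges_in_law_def
proof (intro conjI allI impI)
  note [measurable] = converges_in_law_measurable[OF conv]
  fix f :: "'t \<Rightarrow> real" assume f: "continuous_on UNIV f \<and> bounded (range f)"
  then obtain B where B: "\<And>x. \<bar>f x\<bar> \<le> B" "0 < B"
    by (auto simp: bounded_pos)
  define F where "F x = f (h x)" for x
  have FB: "\<bar>F x\<bar> \<le> B" for x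
    by (simp add: F_def B)
  have fm: "f \<in> borel_measurable borel"
    using f by (intro borel_measurable_continuous_onI) auto
  have Fm [measurable]: "F \<in> borel_measurable borel"
    unfolding F_def by (rule measurable_compose[OF h(1) fm])
  have F: "continuous_on {x. 0 < d x} F"
    unfolding F_def using f by (intro continuous_on_compose2[OF _ h(2), of UNIV f]) auto
  \<comment> \<open>The cutoffs \<open>c k\<close> vanish where \<open>h\<close> may be discontinuous, and increase to \<open>1\<close> elsewhere.\<close>
  define c where "c k x = min 1 (real k * d x)" for k x
  have c01: "0 \<le> c k x" "c k x \<le> 1" for k x
    by (auto simp: c_def d)
  then have c1: "\<bar>c k x\<bar> \<le> 1" for k x
    by simp
  have c: "continuous_on UNIV (c k)" for k
    unfolding c_def by (intro continuous_intros d)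
  have cm [measurable]: "c k \<in> borel_measurable borel" for k
    by (intro borel_measurable_continuous_onI c)
  have cF: "continuous_on UNIV (\<lambda>x. c k x * F x)" for k
  proof (rule continuous_on_dominated_by_vanishing)
    show "continuous_on UNIV (\<lambda>x. real k * d x * B)"
      by (intro continuous_intros d)
    show "\<bar>c k x * F x\<bar> \<le> real k * d x * B" for x
      unfolding abs_mult using d FB by (intro mult_mono) (auto simp: c_def)
    have "{x. 0 < real k * d x * B} \<subseteq> {x. 0 < d x}"
      using d(2) B(2) by (auto simp: zero_less_mult_iff)
    then show "continuous_on {x. 0 < real k * d x * B} (\<lambda>x. c k x * F x)"
      using c F by (intro continuous_intros) (auto intro: continuous_on_subset)
  qed
  have cFB: "\<bar>c k x * F x\<bar> \<le> 1 * B" for k x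
    unfolding abs_mult using c1 FB by (intro mult_mono) auto
  interpret N: prob_space N
    using converges_in_law_measurable[OF conv] by blast
  have Ym: "Y \<in> borel_measurable N"
    by (rule converges_in_law_measurable[OF conv])
  have c_lim: "(\<lambda>k. \<integral>\<omega>. c k (Y \<omega>) \<partial>N) \<longlonglongrightarrow> (\<integral>\<omega>. 1 \<partial>N)"
  proof (rule integral_dominated_convergence[where w = "\<lambda>_. 1"])
    show "AE \<omega> in N. (\<lambda>k. c k (Y \<omega>)) \<longlonglongrightarrow> 1"
      using d_pos
    proof eventually_elim
      fix \<omega> assume pos: "0 < d (Y \<omega>)"
      then obtain k0 :: nat where k0: "1 < real k0 * d (Y \<omega>)"
        using reals_Archimedean3 by blast
      have "c k (Y \<omega>) = 1" if "k0 \<le> k" for k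
      proof -
        have "real k0 * d (Y \<omega>) \<le> real k * d (Y \<omega>)"
          using that pos by (intro mult_right_mono) auto
        then show ?thesis
          using k0 by (simp add: c_def)
      qed
      then have "eventually (\<lambda>k. c k (Y \<omega>) = 1) sequentially"
        unfolding eventually_sequentially by blast
      then show "(\<lambda>k. c k (Y \<omega>)) \<longlonglongrightarrow> 1"
        by (rule tendsto_eventually)
    qed
    show "AE \<omega> in N. norm (c k (Y \<omega>)) \<le> 1" for k
      by (simp add: c1)
  qed (use measurable_compose[OF Ym cm] in auto)
  have "(\<lambda>n. \<integral>\<omega>. F (X n \<omega>) \<partial>M n) \<longlonglongrightarrow> (\<integral>\<omega>. F (Y \<omega>) \<partial>N)"
  proof (rule LIMSEQ_I)
    fix r :: real assume "0 < r"
    define e where "e = r / (2 * (1 + 2 * B))"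
    have "1 + 2 * B \<noteq> 0"
      using B(2) by simp
    then have "e * (1 + 2 * B) = r / 2"
      unfolding e_def by (simp add: divide_simps)
    then have e: "0 < e" "e * (1 + 2 * B) < r"
      using \<open>0 < r\<close> B(2) by (simp add: e_def, linarith)
    have "eventually (\<lambda>k. dist (\<integral>\<omega>. c k (Y \<omega>) \<partial>N) 1 < e / 2) sequentially"
      using tendstoD[OF c_lim, of "e / 2"] e by (simp add: N.prob_space)
    then obtain k where k: "\<bar>(\<integral>\<omega>. c k (Y \<omega>) \<partial>N) - 1\<bar> < e / 2"
      unfolding dist_real_def using eventually_happens by fastforce
    have "(\<lambda>n. \<integral>\<omega>. c k (X n \<omega>) \<partial>M n) \<longlonglongrightarrow> (\<integral>\<omega>. c k (Y \<omega>) \<partial>N)"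
      by (rule converges_in_law_integral[OF conv c c1])
    moreover have "(\<lambda>n. \<integral>\<omega>. c k (X n \<omega>) * F (X n \<omega>) \<partial>M n) \<longlonglongrightarrow> (\<integral>\<omega>. c k (Y \<omega>) * F (Y \<omega>) \<partial>N)"
      by (rule converges_in_law_integral[OF conv cF cFB])
    ultimately have "eventually (\<lambda>n. dist (\<integral>\<omega>. c k (X n \<omega>) \<partial>M n) (\<integral>\<omega>. c k (Y \<omega>) \<partial>N) < e / 2 \<and>
      dist (\<integral>\<omega>. c k (X n \<omega>) * F (X n \<omega>) \<partial>M n) (\<integral>\<omega>. c k (Y \<omega>) * F (Y \<omega>) \<partial>N) < e) sequentially"
      using e by (intro eventually_conj tendstoD) auto
    then have "eventually (\<lambda>n. norm ((\<integral>\<omega>. F (X n \<omega>) \<partial>M n) - (\<integral>\<omega>. F (Y \<omega>) \<partial>N)) < r) sequentially"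
    proof (rule eventually_mono)
      fix n
      let ?I = "\<lambda>G. \<integral>\<omega>. G (X n \<omega>) \<partial>M n" and ?J = "\<lambda>G. \<integral>\<omega>. G (Y \<omega>) \<partial>N"
      assume "dist (?I (c k)) (?J (c k)) < e / 2 \<and> dist (?I (\<lambda>x. c k x * F x)) (?J (\<lambda>x. c k x * F x)) < e"
      then have close: "\<bar>?I (c k) - ?J (c k)\<bar> < e / 2" "\<bar>?I (\<lambda>x. c k x * F x) - ?J (\<lambda>x. c k x * F x)\<bar> < e"
        by (auto simp: dist_real_def)
      have "\<bar>?J F - ?J (\<lambda>x. c k x * F x)\<bar> \<le> B * (1 - ?J (c k))"
        by (rule N.cutoff_error_le[OF Ym Fm cm FB c01])
      moreover have "1 - ?J (c k) \<le> e"
        using k e(1) by linarith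
      then have "B * (1 - ?J (c k)) \<le> B * e"
        using B(2) by simp
      moreover have "\<bar>?I F - ?I (\<lambda>x. c k x * F x)\<bar> \<le> B * (1 - ?I (c k))"
        using converges_in_law_measurable[OF conv]
        by (intro prob_space.cutoff_error_le[OF _ _ Fm cm FB c01])
      moreover have "1 - ?I (c k) \<le> e"
        using k close(1) by linarith
      then have "B * (1 - ?I (c k)) \<le> B * e"
        using B(2) by simp
      ultimately have "\<bar>?I F - ?J F\<bar> < e + 2 * (B * e)"
        using close(2) by linarith
      also have "\<dots> = e * (1 + 2 * B)"
        by (simp add: algebra_simps)
      finally show "norm (?I F - ?J F) < r"
        using e(2) by simp
    qed
    then show "\<exists>n0. \<forall>n\<ge>n0. norm ((\<integral>\<omega>. F (X n \<omega>) \<partial>M n) - (\<integral>\<omega>. F (Y \<omega>) \<partial>N)) < r"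
      by (simp add: eventually_sequentially)
  qed
  moreover have "(\<integral>\<omega>. F (Y \<omega>) \<partial>N) = (\<integral>\<omega>. f (Y' \<omega>) \<partial>N)"
    using Y'(2) measurable_compose[OF Ym Fm] measurable_compose[OF Y'(1) fm]
    by (intro integral_cong_AE) (auto simp: F_def)
  ultimately show "(\<lambda>n. \<integral>\<omega>. f (h (X n \<omega>)) \<partial>M n) \<longlonglongrightarrow> (\<integral>\<omega>. f (Y' \<omega>) \<partial>N)"
    by (simp add: F_def)
qed (use converges_in_law_measurable[OF conv] measurable_compose[OF _ h(1)] Y'(1) in auto)

text \<open>
  An open set in the product is a countable union of open rectangles as soon as one of the two
  factors has a countable base: for each basic set in that factor take the largest open set in the
  other one. This covers pairs whose first component is a random \<open>C\<^sup>2\<close> function and whose second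
  component is a Euclidean random vector.
\<close>

lemma borel_measurable_Pair_second_countable:
  fixes f :: "'a \<Rightarrow> 'b::topological_space" and g :: "'a \<Rightarrow> 'c::second_countable_topology"
  assumes f: "f \<in> borel_measurable M" and g: "g \<in> borel_measurable M"
  shows "(\<lambda>x. (f x, g x)) \<in> borel_measurable M"
proof (rule borel_measurableI)
  fix W :: "('b \<times> 'c) set" assume W: "open W"
  obtain \<B> :: "'c set set" where \<B>: "countable \<B>" "topological_basis \<B>"
    using ex_countable_basis by blast
  define U where "U B = \<Union>{A. open A \<and> A \<times> B \<subseteq> W}" for B
  have U: "open (U B)" for B
    unfolding U_def by (intro open_Union) auto
  have "W = (\<Union>B\<in>\<B>. U B \<times> B)"
  proof (rule subset_antisym; rule subsetI)
    fix p assume "p \<in> W"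
    then obtain A C where AC: "open A" "open C" "p \<in> A \<times> C" "A \<times> C \<subseteq> W"
      using W by (auto elim: open_prod_elim)
    then obtain B where B: "B \<in> \<B>" "snd p \<in> B" "B \<subseteq> C"
      using topological_basisE[OF \<B>(2), of C "snd p"] by (metis mem_Times_iff)
    then have "A \<subseteq> U B"
      using AC unfolding U_def by blast
    then show "p \<in> (\<Union>B\<in>\<B>. U B \<times> B)"
      using B AC by auto
  qed (auto simp: U_def)
  then have "(\<lambda>x. (f x, g x)) -` W \<inter> space M =
      (\<Union>B\<in>\<B>. (f -` U B \<inter> space M) \<inter> (g -` B \<inter> space M))"
    by auto
  also have "\<dots> \<in> sets M"
  proof (rule sets.countable_UN''[OF \<B>(1)])
    fix B assume "B \<in> \<B>"
    then have "g -` B \<inter> space M \<in> sets M"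
      using \<B>(2) by (intro measurable_sets[OF g]) (simp add: topological_basis_open)
    moreover have "f -` U B \<inter> space M \<in> sets M"
      using U by (intro measurable_sets[OF f]) simp
    ultimately show "(f -` U B \<inter> space M) \<inter> (g -` B \<inter> space M) \<in> sets M"
      by blast
  qed
  finally show "(\<lambda>x. (f x, g x)) -` W \<inter> space M \<in> sets M" .
qed

text \<open>
  Convergence in law concerns only the law of the limit, so a limit \<open>h \<circ> W\<close> may be realised on
  the image of \<open>N\<close> under \<open>W\<close>.
\<close>

lemma converges_in_law_distr_limit:
  fixes h :: "'b::topological_space \<Rightarrow> 't::topological_space"
  assumes conv: "converges_in_law M X N (\<lambda>\<omega>. h (W \<omega>))" and W: "W \<in> borel_measurable N"
    and h: "h \<in> borel_measurable borel"
  shows "converges_in_law M X (distr N borel W) h"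
  unfolding converges_in_law_def
proof (intro conjI allI impI)
  fix f :: "'t \<Rightarrow> real" assume f: "continuous_on UNIV f \<and> bounded (range f)"
  then have "f \<in> borel_measurable borel"
    by (intro borel_measurable_continuous_onI) auto
  then have "(\<integral>x. f (h x) \<partial>distr N borel W) = (\<integral>\<omega>. f (h (W \<omega>)) \<partial>N)"
    using measurable_compose[OF h] by (intro integral_distr[OF W]) 
  then show "(\<lambda>n. \<integral>\<omega>. f (X n \<omega>) \<partial>M n) \<longlonglongrightarrow> (\<integral>x. f (h x) \<partial>distr N borel W)"
    using conv f by (simp add: converges_in_law_def)
qed (use conv W h in \<open>auto simp: converges_in_law_def intro: prob_space.prob_space_distr\<close>)

section \<open>Conditional laws and the multivariate normal distribution\<close>

text \<open>
  By Fubini's theorem the total mass is a product of total masses of one-dimensional normal laws.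
\<close>

lemma prob_space_std_mv_normal: "prob_space (std_mv_normal :: (real^'p::finite) measure)"
proof
  have Basis: "(Basis :: (real^'p) set) = range (\<lambda>i. axis i 1)"
    by (auto simp: Basis_vec_def)
  have inj: "inj (\<lambda>i :: 'p. axis i (1 :: real))"
    by (auto simp: inj_on_def axis_eq_axis)
  have eq: "ennreal (\<Prod>i\<in>UNIV. std_normal_density (x $ i)) =
      (\<Prod>b\<in>Basis. ennreal (std_normal_density (x \<bullet> b)))" for x :: "real^'p"
    unfolding Basis prod.reindex[OF inj] by (simp add: inner_axis prod_ennreal)
  have one: "(\<integral>\<^sup>+x. ennreal (std_normal_density x) \<partial>lborel) = 1"
    using prob_space.emeasure_space_1[OF prob_space_normal_density[of 1 0]]
    by (simp add: emeasure_density)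
  have "emeasure (std_mv_normal :: (real^'p) measure) (space std_mv_normal) =
      (\<integral>\<^sup>+x. ennreal (\<Prod>i\<in>UNIV. std_normal_density (x $ i)) \<partial>(lborel :: (real^'p) measure))"
    unfolding std_mv_normal_def by (simp add: emeasure_density)
  also have "\<dots> = (\<integral>\<^sup>+x. (\<Prod>b\<in>Basis. ennreal (std_normal_density (x \<bullet> b))) \<partial>(lborel :: (real^'p) measure))"
    unfolding eq ..
  also have "\<dots> = 1"
    by (subst nn_integral_lborel_prod) (simp_all add: one)
  finally show "emeasure (std_mv_normal :: (real^'p) measure) (space std_mv_normal) = 1" .
qed

lemma sets_std_mv_normal [measurable_cong, simp]: "sets std_mv_normal = sets borel"
  and space_std_mv_normal [simp]: "space std_mv_normal = UNIV"
  by (simp_all add: std_mv_normal_def)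

lemma mv_normal_standard: "mv_normal 0 (mat 1) = (std_mv_normal :: (real^'p::finite) measure)"
  unfolding mv_normal_def matrix_sqrt_mat_1 by (simp add: distr_id2)

text \<open>
  The defining property of conditional expectation, tested on the event \<open>K \<in> A\<close>, which belongs
  to the conditioning \<open>\<sigma>\<close>-algebra.
\<close>

lemma real_cond_exp_integral_indicator:
  assumes P: "prob_space P" and Z [measurable]: "Z \<in> borel_measurable P" and K [measurable]: "K \<in> borel_measurable P"
    and A [measurable]: "A \<in> sets borel" and B [measurable]: "B \<in> sets borel"
  shows "integrable P (\<lambda>y. indicator A (K y) *
      real_cond_exp P (vimage_algebra (space P) K borel) (\<lambda>y. indicator B (Z y)) y)"
    and "(\<integral>y. indicator A (K y) *
      real_cond_exp P (vimage_algebra (space P) K borel) (\<lambda>y. indicator B (Z y)) y \<partial>P) =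
      measure P {y \<in> space P. K y \<in> A \<and> Z y \<in> B}"
proof -
  let ?F = "vimage_algebra (space P) K borel"
  interpret P: prob_space P by (rule P)
  have "subalgebra P ?F"
    unfolding subalgebra_def using measurable_sets[OF K]
    by (auto simp: sets_vimage_algebra2)
  then interpret finite_measure_subalgebra P ?F
    by unfold_locales
  have KF: "(\<lambda>y. indicator A (K y) :: real) \<in> borel_measurable ?F"
    by (rule measurable_compose[OF measurable_vimage_algebra1]) auto
  have ind: "indicator A (K y) * indicator B (Z y) =
      (indicator {y \<in> space P. K y \<in> A \<and> Z y \<in> B} y :: real)" if "y \<in> space P" for y
    using that by (simp add: indicator_def)
  have S: "{y \<in> space P. K y \<in> A \<and> Z y \<in> B} \<in> sets P"
    by measurable
  have "integrable P (indicator {y \<in> space P. K y \<in> A \<and> Z y \<in> B} :: _ \<Rightarrow> real)"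
    using S by (intro integrable_real_indicator) (auto simp: P.emeasure_eq_measure)
  then have int: "integrable P (\<lambda>y. indicator A (K y) * indicator B (Z y) :: real)"
    by (subst Bochner_Integration.integrable_cong[OF refl ind])
  show "integrable P (\<lambda>y. indicator A (K y) * real_cond_exp P ?F (\<lambda>y. indicator B (Z y)) y)"
    by (rule real_cond_exp_intg(1)[OF int KF]) measurable
  have "(\<integral>y. indicator A (K y) * real_cond_exp P ?F (\<lambda>y. indicator B (Z y)) y \<partial>P) =
      (\<integral>y. indicator A (K y) * indicator B (Z y) \<partial>P)"
    by (rule real_cond_exp_intg(2)[OF int KF]) measurable
  also have "\<dots> = measure P {y \<in> space P. K y \<in> A \<and> Z y \<in> B}"
    using S by (subst Bochner_Integration.integral_cong[OF refl ind]) auto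
  finally show "(\<integral>y. indicator A (K y) * real_cond_exp P ?F (\<lambda>y. indicator B (Z y)) y \<partial>P) =
      measure P {y \<in> space P. K y \<in> A \<and> Z y \<in> B}" .
qed

lemma measurable_Pair_kernel:
  assumes [measurable]: "K \<in> measurable P N" "case_prod T \<in> measurable (N \<Otimes>\<^sub>M Q) L"
  shows "(\<lambda>(y, x). (K y, T (K y) x)) \<in> measurable (P \<Otimes>\<^sub>M Q) (N \<Otimes>\<^sub>M L)"
  by measurable

text \<open>
  If the conditional law of \<open>Z\<close> given \<open>K = k\<close> is that of \<open>T k \<xi>\<close> with \<open>\<xi>\<close> distributed as \<open>Q\<close>, then
  \<open>(K, Z)\<close> is distributed as \<open>(K, T K \<xi>)\<close> with \<open>\<xi>\<close> independent of \<open>K\<close>. Both laws agree on measurable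
  rectangles, by the definition of the conditional law and by Fubini's theorem.
\<close>

lemma has_conditional_law_joint_distr:
  fixes Z :: "'y \<Rightarrow> 'z::topological_space" and K :: "'y \<Rightarrow> 'k::topological_space"
  assumes P: "prob_space P" and Z [measurable]: "Z \<in> borel_measurable P" and K [measurable]: "K \<in> borel_measurable P"
    and Q: "prob_space Q" and T [measurable]: "case_prod T \<in> borel_measurable (borel \<Otimes>\<^sub>M Q)"
    and cond: "has_conditional_law P Z K (\<lambda>k. distr Q borel (T k))"
  shows "distr P (borel \<Otimes>\<^sub>M borel) (\<lambda>y. (K y, Z y)) =
    distr (P \<Otimes>\<^sub>M Q) (borel \<Otimes>\<^sub>M borel) (\<lambda>(y, x). (K y, T (K y) x))"
    (is "?L = ?R")
proof -
  interpret P: prob_space P by (rule P)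
  interpret Q: prob_space Q by (rule Q)
  let ?E = "{a \<times> b | a b. a \<in> sets (borel :: 'k measure) \<and> b \<in> sets (borel :: 'z measure)}"
  have Tk [measurable]: "T k \<in> borel_measurable Q" for k
    using measurable_Pair_compose_split[OF T measurable_const[of k] measurable_ident] by simp
  have R_meas [measurable]: "(\<lambda>(y, x). (K y, T (K y) x)) \<in> measurable (P \<Otimes>\<^sub>M Q) (borel \<Otimes>\<^sub>M borel)"
    by (rule measurable_Pair_kernel[OF K T])
  show ?thesis
  proof (rule measure_eqI_generator_eq[OF Int_stable_pair_measure_generator, where \<Omega> = UNIV and A = "\<lambda>_. UNIV"])
    show "sets ?L = sigma_sets UNIV ?E" "sets ?R = sigma_sets UNIV ?E"
      using sets_pair_measure[of "borel :: 'k measure" "borel :: 'z measure"] by simp_all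
    show "range (\<lambda>_. UNIV) \<subseteq> ?E"
      by (auto intro!: exI[of _ UNIV])
    have "prob_space ?L"
      by (rule P.prob_space_distr) measurable
    then show "emeasure ?L UNIV \<noteq> \<infinity>"
      using finite_measure.emeasure_finite[OF prob_space.axioms(1)] by simp
  next
    fix X assume "X \<in> ?E"
    then obtain A B where X: "X = A \<times> B" and A [measurable]: "A \<in> sets borel" and B [measurable]: "B \<in> sets borel"
      by auto
    have "emeasure ?L X = ennreal (measure P {y \<in> space P. K y \<in> A \<and> Z y \<in> B})"
      by (simp add: X emeasure_distr P.emeasure_eq_measure vimage_def Int_def conj_commute)
    also have "\<dots> = ennreal (\<integral>y. indicator A (K y) *
        real_cond_exp P (vimage_algebra (space P) K borel) (\<lambda>y. indicator B (Z y)) y \<partial>P)"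
      by (subst real_cond_exp_integral_indicator(2)[OF P Z K A B]) simp
    also have "\<dots> = (\<integral>\<^sup>+y. ennreal (indicator A (K y) *
        real_cond_exp P (vimage_algebra (space P) K borel) (\<lambda>y. indicator B (Z y)) y) \<partial>P)"
    proof (rule nn_integral_eq_integral[symmetric])
      show "AE y in P. 0 \<le> indicator A (K y) *
          real_cond_exp P (vimage_algebra (space P) K borel) (\<lambda>y. indicator B (Z y)) y"
        using cond[unfolded has_conditional_law_def, rule_format, OF B] by eventually_elim simp
    qed (rule real_cond_exp_integral_indicator(1)[OF P Z K A B])
    also have "\<dots> = (\<integral>\<^sup>+y. emeasure Q (Pair y -` ((\<lambda>(y, x). (K y, T (K y) x)) -` X \<inter> space (P \<Otimes>\<^sub>M Q))) \<partial>P)"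
    proof (rule nn_integral_cong_AE)
      show "AE y in P. ennreal (indicator A (K y) *
          real_cond_exp P (vimage_algebra (space P) K borel) (\<lambda>y. indicator B (Z y)) y) =
          emeasure Q (Pair y -` ((\<lambda>(y, x). (K y, T (K y) x)) -` X \<inter> space (P \<Otimes>\<^sub>M Q)))"
        using cond[unfolded has_conditional_law_def, rule_format, OF B] AE_space
      proof eventually_elim
        fix y assume y: "y \<in> space P" and c:
          "real_cond_exp P (vimage_algebra (space P) K borel) (\<lambda>y. indicator B (Z y)) y =
            measure (distr Q borel (T (K y))) B"
        have "Pair y -` ((\<lambda>(y, x). (K y, T (K y) x)) -` X \<inter> space (P \<Otimes>\<^sub>M Q)) =
            (if K y \<in> A then T (K y) -` B \<inter> space Q else {})"
          using y by (auto simp: X space_pair_measure)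
        then show "ennreal (indicator A (K y) *
            real_cond_exp P (vimage_algebra (space P) K borel) (\<lambda>y. indicator B (Z y)) y) =
            emeasure Q (Pair y -` ((\<lambda>(y, x). (K y, T (K y) x)) -` X \<inter> space (P \<Otimes>\<^sub>M Q)))"
          unfolding c by (simp add: measure_distr Q.emeasure_eq_measure)
      qed
    qed
    also have "\<dots> = emeasure ?R X"
      by (simp add: emeasure_distr X Q.emeasure_pair_measure_alt)
    finally show "emeasure ?L X = emeasure ?R X" .
  qed auto
qed

section \<open>Standardizing a conditionally normal vector\<close>

text \<open>
  For positive definite \<open>k\<close> this equals \<open>k\<^bsup>-1/2\<^esup> z\<close>. It is written as \<open>k\<^bsup>1/2\<^esup> (k\<inverse> z)\<close>, the form in
  which it arises as the limit of the normalised estimate. The value \<open>0\<close> elsewhere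
  keeps it a Borel function.
\<close>

definition standardize :: "real^'p::finite^'p \<Rightarrow> real^'p \<Rightarrow> real^'p" where
  "standardize k z = (if pos_def k then matrix_sqrt k *v (matrix_inv k *v z) else 0)"

lemma borel_measurable_matrix_vector_mult:
  "(\<lambda>(A :: real^'p^'q, x :: real^'p::finite). A *v x) \<in> borel_measurable borel"
  unfolding matrix_vector_mult_def case_prod_unfold
  by (intro borel_measurable_continuous_onI continuous_intros)

lemma pos_def_set_borel: "{k :: real^'p::finite^'p. pos_def k} \<in> sets borel"
proof -
  have "{k :: real^'p^'p. pos_def k} =
      {k. pos_semidef k} \<inter> {k. \<forall>x. x \<noteq> 0 \<longrightarrow> 0 < x \<bullet> (k *v x)}"
    using pos_def_imp_pos_semidef by (auto simp: pos_def_def pos_semidef_def)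
  also have "\<dots> \<in> sets borel"
    by (intro sets.Int borel_closed closed_pos_semidef borel_open open_pos_quadratic_form)
  finally show ?thesis .
qed

lemma borel_measurable_standardize:
  "(\<lambda>(k :: real^'p::finite^'p, z). standardize k z) \<in> borel_measurable borel"
proof -
  have inv: "(\<lambda>p :: (real^'p^'p) \<times> (real^'p). matrix_inv (fst p) *v snd p) \<in> borel_measurable borel"
    using borel_measurable_matrix_inv_vector by (simp add: case_prod_unfold)
  have sqrt: "(\<lambda>p :: (real^'p^'p) \<times> (real^'p). matrix_sqrt (fst p)) \<in> borel_measurable borel"
    by (intro measurable_compose[OF _ borel_measurable_matrix_sqrt] borel_measurable_continuous_onI
        continuous_intros)
  have "(\<lambda>p :: (real^'p^'p) \<times> (real^'p). matrix_sqrt (fst p) *v (matrix_inv (fst p) *v snd p))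
      \<in> borel_measurable borel"
    using measurable_compose[OF borel_measurable_Pair[OF sqrt inv] borel_measurable_matrix_vector_mult]
    by simp
  moreover have "fst -` {k. pos_def k} \<in> sets (borel :: ((real^'p^'p) \<times> (real^'p)) measure)"
    using measurable_sets[OF borel_measurable_continuous_onI[OF continuous_on_fst[OF continuous_on_id]] pos_def_set_borel]
    by simp
  ultimately show ?thesis
    unfolding standardize_def case_prod_unfold by (intro measurable_If) (auto simp: vimage_def)
qed

lemma standardize_matrix_sqrt:
  assumes "pos_def k"
  shows "standardize k (matrix_sqrt k *v x) = x"
proof -
  let ?B = "matrix_sqrt k"
  have B: "?B ** ?B = k"
    using assms by (simp add: matrix_sqrt_square pos_def_imp_pos_semidef)
  have inv: "matrix_inv k ** k = mat 1" "k ** matrix_inv k = mat 1"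
    using assms pos_def_invertible matrix_inv_left matrix_inv_right by blast+
  have "?B ** (?B ** matrix_inv k) = mat 1"
    using inv(2) by (simp add: matrix_mul_assoc B)
  then have "(?B ** matrix_inv k) ** ?B = mat 1"
    using matrix_left_right_inverse by blast
  then show ?thesis
    using assms by (simp add: standardize_def matrix_vector_mul_assoc matrix_mul_assoc)
qed

text \<open>
  In the representation of \<open>(K, Z)\<close> as \<open>(K, K\<^bsup>1/2\<^esup> \<xi>)\<close>, standardizing recovers \<open>\<xi>\<close>.
\<close>

lemma distr_standardize_conditional_normal:
  fixes Z :: "'y \<Rightarrow> real^'p::finite"
  assumes P: "prob_space P" and Z [measurable]: "Z \<in> borel_measurable P" and K [measurable]: "K \<in> borel_measurable P"
    and pd: "AE y in P. pos_def (K y)"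
    and cond: "has_conditional_law P Z K (\<lambda>k. mv_normal 0 k)"
  shows "distr P borel (\<lambda>y. standardize (K y) (Z y)) = std_mv_normal"
proof (rule measure_eqI)
  interpret P: prob_space P by (rule P)
  interpret Q: prob_space "std_mv_normal :: (real^'p) measure" by (rule prob_space_std_mv_normal)
  let ?Q = "std_mv_normal :: (real^'p) measure"
  let ?T = "\<lambda>k x. 0 + matrix_sqrt k *v x :: real^'p"
  have S [measurable]: "(\<lambda>(k :: real^'p^'p, z). standardize k z) \<in> borel_measurable (borel \<Otimes>\<^sub>M borel)"
    using borel_measurable_standardize by (simp add: borel_prod)
  have "case_prod ?T \<in> borel_measurable (borel :: ((real^'p^'p) \<times> (real^'p)) measure)"
  proof -
    have "(\<lambda>p :: (real^'p^'p) \<times> (real^'p). matrix_sqrt (fst p)) \<in> borel_measurable borel"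
      "(\<lambda>p :: (real^'p^'p) \<times> (real^'p). snd p) \<in> borel_measurable borel"
      by (intro measurable_compose[OF _ borel_measurable_matrix_sqrt] borel_measurable_continuous_onI
        continuous_intros)+
    from measurable_compose[OF borel_measurable_Pair[OF this] borel_measurable_matrix_vector_mult]
    show ?thesis
      by (simp add: case_prod_unfold)
  qed
  moreover have "sets (borel \<Otimes>\<^sub>M ?Q) = sets (borel :: ((real^'p^'p) \<times> (real^'p)) measure)"
    using sets_pair_measure_cong[OF refl sets_std_mv_normal, of "borel :: (real^'p^'p) measure"]
    by (simp only: borel_prod)
  ultimately have T [measurable]: "case_prod ?T \<in> borel_measurable (borel \<Otimes>\<^sub>M ?Q)"
    using measurable_cong_sets[OF _ refl] by blast
  have joint: "distr P (borel \<Otimes>\<^sub>M borel) (\<lambda>y. (K y, Z y)) =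
      distr (P \<Otimes>\<^sub>M ?Q) (borel \<Otimes>\<^sub>M borel) (\<lambda>(y, x). (K y, ?T (K y) x))"
    using cond unfolding mv_normal_def by (intro has_conditional_law_joint_distr P Z K Q.prob_space_axioms T)
  have R: "(\<lambda>(y, x). (K y, ?T (K y) x)) \<in> measurable (P \<Otimes>\<^sub>M ?Q) (borel \<Otimes>\<^sub>M borel)"
    by (rule measurable_Pair_kernel[OF K T])
  have SR: "(\<lambda>(y, x). standardize (K y) (?T (K y) x)) \<in> borel_measurable (P \<Otimes>\<^sub>M ?Q)"
    using measurable_compose[OF R S] by (simp only: case_prod_unfold fst_conv snd_conv)
  fix B assume "B \<in> sets (distr P borel (\<lambda>y. standardize (K y) (Z y)))"
  then have B [measurable]: "B \<in> sets borel"
    by simp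
  have "emeasure (distr P borel (\<lambda>y. standardize (K y) (Z y))) B =
      emeasure (distr (distr P (borel \<Otimes>\<^sub>M borel) (\<lambda>y. (K y, Z y))) borel (\<lambda>(k, z). standardize k z)) B"
    by (subst distr_distr) (simp_all add: comp_def)
  also have "\<dots> = emeasure (distr (P \<Otimes>\<^sub>M ?Q) borel (\<lambda>(y, x). standardize (K y) (?T (K y) x))) B"
    unfolding joint distr_distr[OF S R] by (simp only: comp_def case_prod_unfold fst_conv snd_conv)
  also have "\<dots> = emeasure (P \<Otimes>\<^sub>M ?Q)
      ((\<lambda>(y, x). standardize (K y) (?T (K y) x)) -` B \<inter> space (P \<Otimes>\<^sub>M ?Q))"
    by (rule emeasure_distr[OF SR B])
  also have "\<dots> = (\<integral>\<^sup>+y. emeasure ?Q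
      (Pair y -` ((\<lambda>(y, x). standardize (K y) (?T (K y) x)) -` B \<inter> space (P \<Otimes>\<^sub>M ?Q))) \<partial>P)"
    by (rule Q.emeasure_pair_measure_alt[OF measurable_sets[OF SR B]])
  also have "\<dots> = (\<integral>\<^sup>+y. emeasure ?Q B \<partial>P)"
  proof (rule nn_integral_cong_AE)
    show "AE y in P. emeasure ?Q
      (Pair y -` ((\<lambda>(y, x). standardize (K y) (?T (K y) x)) -` B \<inter> space (P \<Otimes>\<^sub>M ?Q))) = emeasure ?Q B"
      using pd AE_space
    proof eventually_elim
      fix y assume "pos_def (K y)" "y \<in> space P"
      then have "Pair y -` ((\<lambda>(y, x). standardize (K y) (?T (K y) x)) -` B \<inter> space (P \<Otimes>\<^sub>M ?Q)) = B"
        by (auto simp: space_pair_measure standardize_matrix_sqrt)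
      then show "emeasure ?Q
        (Pair y -` ((\<lambda>(y, x). standardize (K y) (?T (K y) x)) -` B \<inter> space (P \<Otimes>\<^sub>M ?Q))) = emeasure ?Q B"
        by simp
    qed
  qed
  also have "\<dots> = emeasure ?Q B"
    by (simp add: P.emeasure_space_1)
  finally show "emeasure (distr P borel (\<lambda>y. standardize (K y) (Z y))) B = emeasure ?Q B" .
qed simp

section \<open>Continuity tools for the Newton step\<close>

lemma continuous_on_Obj: "continuous_on UNIV Obj"
  unfolding continuous_on_open_invariant by (metis open_nao_def Int_UNIV_right)

lemma continuous_on_Obj_comp [continuous_intros]:
  "continuous_on S f \<Longrightarrow> continuous_on S (\<lambda>x. Obj (f x))"
  using continuous_on_compose2[OF continuous_on_Obj] by blast

lemma continuous_on_matrix_vector_mult [continuous_intros]: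
  fixes A :: "'a::topological_space \<Rightarrow> real^'p::finite^'q::finite"
  shows "continuous_on S A \<Longrightarrow> continuous_on S x \<Longrightarrow> continuous_on S (\<lambda>y. A y *v x y)"
  unfolding matrix_vector_mult_def by (intro continuous_intros)

text \<open>
  Positive definiteness without symmetry, so that the set is open in the space of all matrices.
\<close>

definition pos_form :: "(real^'p::finite^'p) set" where
  "pos_form = {A. \<forall>x. x \<noteq> 0 \<longrightarrow> 0 < x \<bullet> (A *v x)}"

lemma pos_def_iff_pos_form: "pos_def A \<longleftrightarrow> transpose A = A \<and> A \<in> pos_form"
  by (simp add: pos_def_def pos_form_def)

text \<open>
  The distance to a nonempty closed set is continuous and vanishes exactly on that set, so it
  yields cutoffs that live on \<open>pos_form\<close>.
\<close>

definition pos_gap :: "real^'p::finite^'p \<Rightarrow> real" where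
  "pos_gap A = infdist A (- pos_form)"

lemma pos_gap_nonneg: "0 \<le> pos_gap A"
  by (simp add: pos_gap_def infdist_nonneg)

lemma pos_gap_pos_iff: "0 < pos_gap A \<longleftrightarrow> A \<in> pos_form"
proof
  have "closed (- pos_form :: (real^'p^'p) set)"
    unfolding pos_form_def by (intro closed_Compl open_pos_quadratic_form)
  moreover have "(0 :: real^'p^'p) \<in> - pos_form"
    by (auto simp: pos_form_def intro!: exI[of _ "axis undefined 1"])
  ultimately show "A \<in> pos_form \<Longrightarrow> 0 < pos_gap A"
    unfolding pos_gap_def by (intro infdist_pos_not_in_closed) auto
  show "0 < pos_gap A \<Longrightarrow> A \<in> pos_form"
    unfolding pos_gap_def using infdist_zero[of A "- pos_form"] by fastforce
qed

lemma continuous_on_pos_gap [continuous_intros]: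
  "continuous_on S f \<Longrightarrow> continuous_on S (\<lambda>x. pos_gap (f x))"
  unfolding pos_gap_def by (rule continuous_on_infdist)

section \<open>The Newton step as a function on the product space\<close>

text \<open>
  The observed Fisher information.
\<close>

abbreviation info :: "('p::finite) c2 \<Rightarrow> real^'p \<Rightarrow> real^'p^'p" where
  "info q x \<equiv> - c2_hessian q x"

text \<open>
  Hessians are symmetric, so the open condition \<open>pos_form\<close> captures their positive definiteness.
\<close>

lemma pos_def_info_iff: "pos_def (info q x) \<longleftrightarrow> info q x \<in> pos_form"
proof -
  have "transpose (info q x) = info q x"
    using hessian_symmetric[OF twice_continuously_differentiable_c2_fun, of q x]
    by (simp add: transpose_def vec_eq_iff)
  then show ?thesis
    by (simp add: pos_def_iff_pos_form)
qed

text \<open>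
  The Newton step without \<open>NaO\<close>; it is meaningful on \<open>newton_defined\<close>.
\<close>

definition newton_point :: "('p::finite) c2 \<Rightarrow> real^'p \<Rightarrow> real^'p" where
  "newton_point q x = x + matrix_inv (info q x) *v c2_gradient q x"

lemma newton_step_Obj:
  "newton_step q (Obj x) = (if info q x \<in> pos_form then Obj (newton_point q x) else NaO)"
  by (simp add: newton_step_def newton_point_def pos_def_info_iff)

definition newton_statistics :: "('p::finite) c2 \<times> (real^'p) \<Rightarrow>
    'p c2 \<times> (real^'p) \<times> (real^'p^'p) \<times> (real^'p^'p) nao \<times> (real^'p) nao \<times> (real^'p) nao" where
  "newton_statistics = (\<lambda>(q, x). (q, x, info q x, map_nao (info q) (newton_step q (Obj x)),
     newton_step q (Obj x),
     map2_nao (*v) (bind_nao (\<lambda>y. pos_def_sqrt (info q y)) (newton_step q (Obj x)))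
       (newton_step q (Obj x))))"

definition newton_defined :: "(('p::finite) c2 \<times> (real^'p)) set" where
  "newton_defined = {p. info (fst p) (snd p) \<in> pos_form}"

definition updated_info_pos :: "(('p::finite) c2 \<times> (real^'p)) set" where
  "updated_info_pos = {p. info (fst p) (newton_point (fst p) (snd p)) \<in> pos_form}"

lemma newton_statistics_eq:
  "newton_statistics p = (fst p, snd p, info (fst p) (snd p),
    if p \<in> newton_defined then Obj (info (fst p) (newton_point (fst p) (snd p))) else NaO,
    if p \<in> newton_defined then Obj (newton_point (fst p) (snd p)) else NaO,
    if p \<in> newton_defined \<inter> updated_info_pos
    then Obj (matrix_sqrt (info (fst p) (newton_point (fst p) (snd p))) *v newton_point (fst p) (snd p))
    else NaO)"
  by (cases p) (simp add: newton_statistics_def newton_step_Obj newton_defined_def updated_info_pos_def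
      map2_nao_def pos_def_sqrt_def pos_def_info_iff)

lemma continuous_on_info [continuous_intros]:
  assumes "continuous_on S q" "continuous_on S x"
  shows "continuous_on S (\<lambda>y. info (q y) (x y))"
  using continuous_on_compose2[OF continuous_on_c2_hessian continuous_on_Pair[OF assms]]
  by (intro continuous_intros) simp

lemma continuous_on_newton_point:
  "continuous_on newton_defined (\<lambda>p :: ('p::finite) c2 \<times> (real^'p). newton_point (fst p) (snd p))"
proof -
  have "continuous_on newton_defined (\<lambda>p :: 'p c2 \<times> (real^'p). (info (fst p) (snd p), c2_gradient (fst p) (snd p)))"
    by (intro continuous_intros continuous_on_subset[OF continuous_on_c2_gradient]) auto
  moreover have "det (info (fst p) (snd p)) \<noteq> 0" if "p \<in> newton_defined" for p :: "'p c2 \<times> (real^'p)"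
    using that pos_def_invertible[of "info (fst p) (snd p)"]
    by (simp add: newton_defined_def pos_def_info_iff invertible_det_nz)
  ultimately have "continuous_on newton_defined
      (\<lambda>p :: 'p c2 \<times> (real^'p). matrix_inv (info (fst p) (snd p)) *v c2_gradient (fst p) (snd p))"
    using continuous_on_compose2[OF continuous_on_matrix_inv_vector, of newton_defined
        "\<lambda>p :: 'p c2 \<times> (real^'p). (info (fst p) (snd p), c2_gradient (fst p) (snd p))"]
    by (simp add: image_subset_iff)
  then show ?thesis
    unfolding newton_point_def by (intro continuous_on_add continuous_on_snd continuous_on_id)
qed

text \<open>
  The function \<open>d\<close> for \<open>converges_in_law_continuous_mapping\<close>. The minimum with the gap at the
  starting point makes it tend to zero at the boundary of \<open>newton_defined\<close>, beyond which the
  Newton step, and with it the second gap, has no meaning.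
\<close>

definition newton_gap :: "('p::finite) c2 \<times> (real^'p) \<Rightarrow> real" where
  "newton_gap p = (if p \<in> newton_defined
     then min (pos_gap (info (fst p) (snd p))) (pos_gap (info (fst p) (newton_point (fst p) (snd p))))
     else 0)"

lemma newton_gap_nonneg: "0 \<le> newton_gap p"
  by (simp add: newton_gap_def pos_gap_nonneg)

lemma newton_gap_pos_iff: "0 < newton_gap p \<longleftrightarrow> p \<in> newton_defined \<inter> updated_info_pos"
  by (auto simp: newton_gap_def pos_gap_pos_iff newton_defined_def updated_info_pos_def)

lemma newton_defined_eq: "newton_defined = {p. 0 < pos_gap (info (fst p) (snd p))}"
  by (simp add: newton_defined_def pos_gap_pos_iff)

lemma continuous_on_newton_gap: "continuous_on UNIV (newton_gap :: ('p::finite) c2 \<times> (real^'p) \<Rightarrow> real)"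
proof (rule continuous_on_dominated_by_vanishing)
  show "continuous_on UNIV (\<lambda>p :: 'p c2 \<times> (real^'p). pos_gap (info (fst p) (snd p)))"
    by (intro continuous_intros)
  show "\<bar>newton_gap p\<bar> \<le> pos_gap (info (fst p) (snd p))" for p :: "'p c2 \<times> (real^'p)"
    using newton_gap_nonneg[of p] pos_gap_nonneg[of "info (fst p) (snd p)"]
    by (simp add: newton_gap_def)
  have "continuous_on newton_defined (\<lambda>p :: 'p c2 \<times> (real^'p).
      min (pos_gap (info (fst p) (snd p))) (pos_gap (info (fst p) (newton_point (fst p) (snd p)))))"
    by (intro continuous_intros continuous_on_newton_point)
  then have "continuous_on newton_defined (newton_gap :: 'p c2 \<times> (real^'p) \<Rightarrow> real)"
    by (rule continuous_on_eq) (simp add: newton_gap_def)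
  then show "continuous_on {p :: 'p c2 \<times> (real^'p). 0 < pos_gap (info (fst p) (snd p))} newton_gap"
    by (simp add: newton_defined_eq)
qed

text \<open>
  On each of the three pieces the pattern of \<open>NaO\<close> values is constant.
\<close>

lemma continuous_on_newton_statistics:
  "continuous_on (newton_defined \<inter> updated_info_pos) (newton_statistics :: ('p::finite) c2 \<times> (real^'p) \<Rightarrow> _)"
  "continuous_on (newton_defined - updated_info_pos) (newton_statistics :: ('p::finite) c2 \<times> (real^'p) \<Rightarrow> _)"
  "continuous_on (- newton_defined) (newton_statistics :: ('p::finite) c2 \<times> (real^'p) \<Rightarrow> _)"
proof -
  let ?N = "\<lambda>p :: 'p c2 \<times> (real^'p). newton_point (fst p) (snd p)"
  have N: "continuous_on S ?N" if "S \<subseteq> newton_defined" for S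
    using continuous_on_newton_point that by (rule continuous_on_subset)
  have "continuous_on (newton_defined \<inter> updated_info_pos) (\<lambda>p. info (fst p) (?N p))"
    by (intro continuous_intros N) auto
  then have "continuous_on (newton_defined \<inter> updated_info_pos) (\<lambda>p. matrix_sqrt (info (fst p) (?N p)))"
    by (rule continuous_on_compose2[OF continuous_on_matrix_sqrt])
      (auto simp: updated_info_pos_def simp flip: pos_def_info_iff intro: pos_def_imp_pos_semidef)
  then have "continuous_on (newton_defined \<inter> updated_info_pos) (\<lambda>p. (fst p, snd p, info (fst p) (snd p),
      Obj (info (fst p) (?N p)), Obj (?N p), Obj (matrix_sqrt (info (fst p) (?N p)) *v ?N p)))"
    by (intro continuous_intros N) auto
  then show "continuous_on (newton_defined \<inter> updated_info_pos) (newton_statistics :: 'p c2 \<times> (real^'p) \<Rightarrow> _)"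
    by (rule continuous_on_eq) (simp add: newton_statistics_eq)
  have "continuous_on (newton_defined - updated_info_pos) (\<lambda>p. (fst p, snd p, info (fst p) (snd p),
      Obj (info (fst p) (?N p)), Obj (?N p), NaO :: (real^'p) nao))"
    by (intro continuous_intros N) auto
  then show "continuous_on (newton_defined - updated_info_pos) (newton_statistics :: 'p c2 \<times> (real^'p) \<Rightarrow> _)"
    by (rule continuous_on_eq) (simp add: newton_statistics_eq)
  have "continuous_on (- newton_defined) (\<lambda>p :: 'p c2 \<times> (real^'p). (fst p, snd p, info (fst p) (snd p),
      NaO :: (real^'p^'p) nao, NaO :: (real^'p) nao, NaO :: (real^'p) nao))"
    by (intro continuous_intros)
  then show "continuous_on (- newton_defined) (newton_statistics :: 'p c2 \<times> (real^'p) \<Rightarrow> _)"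
    by (rule continuous_on_eq) (simp add: newton_statistics_eq)
qed

text \<open>
  The three pieces on which the statistics are continuous are Borel sets. Arguing piecewise avoids
  any statement about the Borel sets of the product as a product \<open>\<sigma>\<close>-algebra.
\<close>

lemma borel_measurable_newton_statistics:
  "(newton_statistics :: ('p::finite) c2 \<times> (real^'p) \<Rightarrow> _) \<in> borel_measurable borel"
proof (rule measurable_piecewise_restrict[where
      C = "{newton_defined \<inter> updated_info_pos, newton_defined - updated_info_pos, - newton_defined :: ('p c2 \<times> (real^'p)) set}"])
  have "open (newton_defined :: ('p c2 \<times> (real^'p)) set)"
    unfolding newton_defined_eq by (intro open_Collect_less continuous_intros)
  moreover have "open (newton_defined \<inter> updated_info_pos :: ('p c2 \<times> (real^'p)) set)"
  proof -
    have "newton_defined \<inter> updated_info_pos = {p :: 'p c2 \<times> (real^'p). 0 < newton_gap p}"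
      by (auto simp: newton_gap_pos_iff)
    then show ?thesis
      by (simp add: open_Collect_less continuous_on_newton_gap)
  qed
  moreover have "newton_defined - updated_info_pos = newton_defined - newton_defined \<inter> (updated_info_pos :: ('p c2 \<times> (real^'p)) set)"
    by blast
  ultimately show "\<Omega> \<inter> space borel \<in> sets borel"
    if "\<Omega> \<in> {newton_defined \<inter> updated_info_pos, newton_defined - updated_info_pos, - newton_defined :: ('p c2 \<times> (real^'p)) set}" for \<Omega>
    using that by auto
  show "newton_statistics \<in> borel_measurable (restrict_space borel \<Omega>)"
    if "\<Omega> \<in> {newton_defined \<inter> updated_info_pos, newton_defined - updated_info_pos, - newton_defined :: ('p c2 \<times> (real^'p)) set}" for \<Omega>
    using that continuous_on_newton_statistics by (auto intro: borel_measurable_continuous_on_restrict)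
qed auto

text \<open>
  For a quadratic function the Newton step is exact: from every starting point it reaches the
  maximiser.
\<close>

lemma
  assumes q: "\<And>x. c2_fun q x = x \<bullet> z - (1/2) * (x \<bullet> (K *v x))" and K: "pos_def K"
  shows quadratic_newton_defined: "(q, x) \<in> newton_defined \<inter> updated_info_pos"
    and newton_statistics_quadratic: "newton_statistics (q, x) =
      (q, x, K, Obj K, Obj (matrix_inv K *v z), Obj (standardize K z))"
proof -
  have sym: "transpose K = K" and pos: "K \<in> pos_form"
    using K by (auto simp: pos_def_iff_pos_form)
  have info: "info q y = K" for y
    using hessian_quadratic[of "c2_fun q", OF q sym] by simp
  have "newton_point q x = x + matrix_inv K *v (z - K *v x)"
    using gradient_quadratic[of "c2_fun q", OF q sym] by (simp add: newton_point_def info)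
  also have "\<dots> = matrix_inv K *v z"
    using matrix_inv_left[OF pos_def_invertible[OF K]]
    by (simp add: matrix_vector_mult_diff_distrib matrix_vector_mul_assoc)
  finally have N: "newton_point q x = matrix_inv K *v z" .
  show ok: "(q, x) \<in> newton_defined \<inter> updated_info_pos"
    by (simp add: newton_defined_def updated_info_pos_def info pos)
  then show "newton_statistics (q, x) =
      (q, x, K, Obj K, Obj (matrix_inv K *v z), Obj (standardize K z))"
    by (simp add: newton_statistics_eq info N standardize_def K)
qed

text \<open>
  The limit must be measurable on the null set where \<open>K\<close> and \<open>Z\<close> are unrelated to \<open>q\<close> as well, so it
  is treated as a pair of \<open>(q, \<delta>)\<close> and a Euclidean random vector.
\<close>

lemma borel_measurable_limit_statistics:
  fixes Z :: "'v \<Rightarrow> real^'p::finite"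
  assumes q\<delta>: "(\<lambda>\<omega>. (q \<omega> :: 'p c2, \<delta> \<omega> :: real^'p)) \<in> borel_measurable N"
    and K: "K \<in> borel_measurable N" and Z: "Z \<in> borel_measurable N"
  shows "(\<lambda>\<omega>. (q \<omega>, \<delta> \<omega>, K \<omega>, Obj (K \<omega>), Obj (matrix_inv (K \<omega>) *v Z \<omega>),
    Obj (standardize (K \<omega>) (Z \<omega>)))) \<in> borel_measurable N"
proof -
  have KZ: "(\<lambda>\<omega>. (K \<omega>, Z \<omega>)) \<in> borel_measurable N"
    by (rule borel_measurable_Pair[OF K Z])
  have inv: "(\<lambda>\<omega>. matrix_inv (K \<omega>) *v Z \<omega>) \<in> borel_measurable N"
    using measurable_compose[OF KZ borel_measurable_matrix_inv_vector] by simp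
  have std: "(\<lambda>\<omega>. standardize (K \<omega>) (Z \<omega>)) \<in> borel_measurable N"
    using measurable_compose[OF KZ borel_measurable_standardize] by simp
  have tuple: "(\<lambda>\<omega>. ((q \<omega>, \<delta> \<omega>), K \<omega>, matrix_inv (K \<omega>) *v Z \<omega>, standardize (K \<omega>) (Z \<omega>)))
      \<in> borel_measurable N"
    by (intro borel_measurable_Pair_second_countable q\<delta> borel_measurable_Pair K inv std)
  have reorder: "(\<lambda>p :: ('p c2 \<times> (real^'p)) \<times> (real^'p^'p) \<times> (real^'p) \<times> (real^'p).
      (fst (fst p), snd (fst p), fst (snd p), Obj (fst (snd p)), Obj (fst (snd (snd p))),
        Obj (snd (snd (snd p))))) \<in> borel_measurable borel"
    by (intro borel_measurable_continuous_onI continuous_intros)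
  show ?thesis
    using measurable_compose[OF tuple reorder] by simp
qed

text \<open>
  Almost surely the limit lies in the region where \<open>newton_gap\<close> is positive, so the continuous
  mapping theorem applies. All separate convergences follow from this one by projection.
\<close>

lemma converges_in_law_newton_statistics:
  fixes q :: "'v \<Rightarrow> ('p::finite) c2" and Z \<delta>lim :: "'v \<Rightarrow> real^'p"
  assumes conv: "converges_in_law M (\<lambda>n \<omega>. (q' n \<omega>, \<delta> n \<omega>)) N (\<lambda>\<omega>. (q \<omega>, \<delta>lim \<omega>))"
    and q: "AE \<omega> in N. \<forall>x. c2_fun (q \<omega>) x = x \<bullet> Z \<omega> - (1/2) * (x \<bullet> (K \<omega> *v x))"
    and pd: "AE \<omega> in N. pos_def (K \<omega>)"
    and K: "K \<in> borel_measurable N" and Z: "Z \<in> borel_measurable N"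
  shows "converges_in_law M (\<lambda>n \<omega>. newton_statistics (q' n \<omega>, \<delta> n \<omega>)) N
    (\<lambda>\<omega>. (q \<omega>, \<delta>lim \<omega>, K \<omega>, Obj (K \<omega>), Obj (matrix_inv (K \<omega>) *v Z \<omega>),
      Obj (standardize (K \<omega>) (Z \<omega>))))"
proof (rule converges_in_law_continuous_mapping[OF conv, where d = newton_gap])
  show "AE \<omega> in N. 0 < newton_gap (q \<omega>, \<delta>lim \<omega>)"
    using q pd by eventually_elim (simp only: newton_gap_pos_iff quadratic_newton_defined)
  show "AE \<omega> in N. (q \<omega>, \<delta>lim \<omega>, K \<omega>, Obj (K \<omega>), Obj (matrix_inv (K \<omega>) *v Z \<omega>),
      Obj (standardize (K \<omega>) (Z \<omega>))) = newton_statistics (q \<omega>, \<delta>lim \<omega>)"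
    using q pd by eventually_elim (simp add: newton_statistics_quadratic)
  have "newton_defined \<inter> updated_info_pos = {p :: 'p c2 \<times> (real^'p). 0 < newton_gap p}"
    by (auto simp: newton_gap_pos_iff)
  then show "continuous_on {p. 0 < newton_gap p} (newton_statistics :: 'p c2 \<times> (real^'p) \<Rightarrow> _)"
    using continuous_on_newton_statistics(1) by metis
  show "(\<lambda>\<omega>. (q \<omega>, \<delta>lim \<omega>, K \<omega>, Obj (K \<omega>), Obj (matrix_inv (K \<omega>) *v Z \<omega>),
      Obj (standardize (K \<omega>) (Z \<omega>)))) \<in> borel_measurable N"
    by (rule borel_measurable_limit_statistics[OF converges_in_law_measurable(4)[OF conv] K Z])
qed (rule continuous_on_newton_gap newton_gap_nonneg borel_measurable_newton_statistics)+

text \<open>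
  At parameter value zero the conditional law of the score given \<open>Ks\<close> is centred.
\<close>

lemma distr_standardize_lamn:
  fixes Zs :: "'y \<Rightarrow> real^'p::finite"
  assumes lamn: "lamn_model \<nu> g Zs Ks"
    and Y: "Y \<in> measurable N \<nu>" "distr N \<nu> Y = density \<nu> (g 0)"
    and pd: "AE \<omega> in N. pos_def (Ks (Y \<omega>))"
  shows "distr N borel (\<lambda>\<omega>. standardize (Ks (Y \<omega>)) (Zs (Y \<omega>))) = mv_normal 0 (mat 1)"
proof -
  let ?P = "density \<nu> (g 0)"
  have Zs: "Zs \<in> borel_measurable \<nu>" and Ks: "Ks \<in> borel_measurable \<nu>"
    and P: "prob_space ?P" and
    cond: "\<And>\<theta>. has_conditional_law (density \<nu> (g \<theta>)) Zs Ks (\<lambda>k. mv_normal (k *v \<theta>) k)"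
    using lamn by (auto simp: lamn_model_def parametric_model_def)
  have std: "(\<lambda>y. standardize (Ks y) (Zs y)) \<in> borel_measurable \<nu>"
    using measurable_compose[OF borel_measurable_Pair[OF Ks Zs] borel_measurable_standardize] by simp
  have "{y \<in> space \<nu>. pos_def (Ks y)} \<in> sets \<nu>"
    using measurable_sets[OF Ks pos_def_set_borel] by (simp add: vimage_def Int_def conj_commute)
  then have "AE y in distr N \<nu> Y. pos_def (Ks y)"
    using pd Y(1) by (simp add: AE_distr_iff)
  then have "AE y in ?P. pos_def (Ks y)"
    by (simp only: Y(2))
  moreover have "has_conditional_law ?P Zs Ks (\<lambda>k. mv_normal 0 k)"
    using cond[of 0] by simp
  ultimately have "distr ?P borel (\<lambda>y. standardize (Ks y) (Zs y)) = std_mv_normal"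
    using Zs Ks by (intro distr_standardize_conditional_normal P) auto
  then show ?thesis
    using distr_distr[OF std Y(1)] by (simp add: Y(2) mv_normal_standard comp_def)
qed

theorem theorem4p3:
  fixes M :: "nat \<Rightarrow> 'w measure"
    and X :: "nat \<Rightarrow> 'w \<Rightarrow> 'x"
    and \<mu> :: "nat \<Rightarrow> 'x measure"
    and f :: "nat \<Rightarrow> real^'p::finite \<Rightarrow> 'x \<Rightarrow> real"
    and q\<^sub>n :: "nat \<Rightarrow> 'w \<Rightarrow> 'p c2"
    and \<delta>t :: "nat \<Rightarrow> 'w \<Rightarrow> real^'p"
    and \<delta>h :: "nat \<Rightarrow> 'w \<Rightarrow> (real^'p) nao"
    and N :: "'v measure"
    and Y :: "'v \<Rightarrow> 'y"
    and \<nu> :: "'y measure"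
    and g :: "real^'p \<Rightarrow> 'y \<Rightarrow> real"
    and Zs :: "'y \<Rightarrow> real^'p"
    and Ks :: "'y \<Rightarrow> real^'p^'p"
    and q :: "'v \<Rightarrow> 'p c2"
    and \<delta>lim Z :: "'v \<Rightarrow> real^'p"
    and K :: "'v \<Rightarrow> real^'p^'p"
  assumes log_lik: "\<And>n. log_likelihood 0 (M n) (X n) (\<mu> n) (f n) (q\<^sub>n n)"
    and lamn: "lamn_model \<nu> g Zs Ks"
    and lamn_log_lik: "log_likelihood 0 N Y \<nu> g q"
    and Z: "\<And>\<omega>. Z \<omega> = Zs (Y \<omega>)"
    and K: "\<And>\<omega>. K \<omega> = Ks (Y \<omega>)"
    and q: "AE \<omega> in N. \<forall>\<delta>. c2_fun (q \<omega>) \<delta> = \<delta> \<bullet> Z \<omega> - (1/2) * (\<delta> \<bullet> (K \<omega> *v \<delta>))"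
    and K_pos_def: "AE \<omega> in N. pos_def (K \<omega>)"
    and conv: "converges_in_law M (\<lambda>n \<omega>. (q\<^sub>n n \<omega>, \<delta>t n \<omega>)) N (\<lambda>\<omega>. (q \<omega>, \<delta>lim \<omega>))"
    and newton: "\<And>n \<omega>. \<delta>h n \<omega> = newton_step (q\<^sub>n n \<omega>) (Obj (\<delta>t n \<omega>))"
  shows "converges_in_law M (\<lambda>n \<omega>. - c2_hessian (q\<^sub>n n \<omega>) (\<delta>t n \<omega>)) N K \<and>
    converges_in_law M (\<lambda>n \<omega>. map_nao (\<lambda>\<delta>. - c2_hessian (q\<^sub>n n \<omega>) \<delta>) (\<delta>h n \<omega>)) N
      (\<lambda>\<omega>. Obj (K \<omega>)) \<and>
    converges_in_law M \<delta>h N (\<lambda>\<omega>. Obj (matrix_inv (K \<omega>) *v Z \<omega>)) \<and>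
    converges_in_law M
      (\<lambda>n \<omega>. map2_nao (*v)
        (bind_nao (\<lambda>\<delta>. pos_def_sqrt (- c2_hessian (q\<^sub>n n \<omega>) \<delta>)) (\<delta>h n \<omega>)) (\<delta>h n \<omega>))
      (mv_normal 0 (mat 1)) Obj \<and>
    (\<exists>W :: 'v \<Rightarrow> real^'p. W \<in> borel_measurable N \<and> distr N borel W = mv_normal 0 (mat 1) \<and>
      converges_in_law M
        (\<lambda>n \<omega>. (q\<^sub>n n \<omega>, \<delta>t n \<omega>,
          - c2_hessian (q\<^sub>n n \<omega>) (\<delta>t n \<omega>),
          map_nao (\<lambda>\<delta>. - c2_hessian (q\<^sub>n n \<omega>) \<delta>) (\<delta>h n \<omega>),
          \<delta>h n \<omega>,
          map2_nao (*v)
            (bind_nao (\<lambda>\<delta>. pos_def_sqrt (- c2_hessian (q\<^sub>n n \<omega>) \<delta>)) (\<delta>h n \<omega>)) (\<delta>h n \<omega>)))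
        N
        (\<lambda>\<omega>. (q \<omega>, \<delta>lim \<omega>, K \<omega>, Obj (K \<omega>), Obj (matrix_inv (K \<omega>) *v Z \<omega>), Obj (W \<omega>))))"
proof -
  let ?W = "\<lambda>\<omega>. standardize (K \<omega>) (Z \<omega>)"
  have \<delta>h: "\<delta>h = (\<lambda>n \<omega>. newton_step (q\<^sub>n n \<omega>) (Obj (\<delta>t n \<omega>)))"
    using newton by (intro ext)
  have Y: "Y \<in> measurable N \<nu>" "distr N \<nu> Y = density \<nu> (g 0)"
    using lamn_log_lik by (auto simp: log_likelihood_def)
  have "Zs \<in> borel_measurable \<nu>" "Ks \<in> borel_measurable \<nu>"
    using lamn by (auto simp: lamn_model_def)
  then have Zm: "Z \<in> borel_measurable N" and Km: "K \<in> borel_measurable N"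
    using measurable_compose[OF Y(1)] by (auto simp: Z K cong: measurable_cong)
  have Wm: "?W \<in> borel_measurable N"
    using measurable_compose[OF borel_measurable_Pair[OF Km Zm] borel_measurable_standardize] by simp
  have W_law: "distr N borel ?W = mv_normal 0 (mat 1)"
    using distr_standardize_lamn[OF lamn Y] K_pos_def by (simp add: Z K)
  have joint: "converges_in_law M
      (\<lambda>n \<omega>. (q\<^sub>n n \<omega>, \<delta>t n \<omega>,
        - c2_hessian (q\<^sub>n n \<omega>) (\<delta>t n \<omega>),
        map_nao (\<lambda>\<delta>. - c2_hessian (q\<^sub>n n \<omega>) \<delta>) (\<delta>h n \<omega>),
        \<delta>h n \<omega>,
        map2_nao (*v)
          (bind_nao (\<lambda>\<delta>. pos_def_sqrt (- c2_hessian (q\<^sub>n n \<omega>) \<delta>)) (\<delta>h n \<omega>)) (\<delta>h n \<omega>)))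
      N
      (\<lambda>\<omega>. (q \<omega>, \<delta>lim \<omega>, K \<omega>, Obj (K \<omega>), Obj (matrix_inv (K \<omega>) *v Z \<omega>), Obj (?W \<omega>)))"
    using converges_in_law_newton_statistics[OF conv q K_pos_def Km Zm]
    by (simp add: newton_statistics_def \<delta>h)
  have "converges_in_law M
      (\<lambda>n \<omega>. map2_nao (*v)
        (bind_nao (\<lambda>\<delta>. pos_def_sqrt (- c2_hessian (q\<^sub>n n \<omega>) \<delta>)) (\<delta>h n \<omega>)) (\<delta>h n \<omega>))
      N (\<lambda>\<omega>. Obj (?W \<omega>))"
    using converges_in_law_continuous_image[OF joint, of "\<lambda>p. snd (snd (snd (snd (snd p))))"]
    by (simp add: continuous_intros)
  then have "converges_in_law M
      (\<lambda>n \<omega>. map2_nao (*v)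
        (bind_nao (\<lambda>\<delta>. pos_def_sqrt (- c2_hessian (q\<^sub>n n \<omega>) \<delta>)) (\<delta>h n \<omega>)) (\<delta>h n \<omega>))
      (mv_normal 0 (mat 1)) Obj"
    unfolding W_law[symmetric]
    by (rule converges_in_law_distr_limit[OF _ Wm borel_measurable_continuous_onI[OF continuous_on_Obj]])
  moreover have "converges_in_law M (\<lambda>n \<omega>. - c2_hessian (q\<^sub>n n \<omega>) (\<delta>t n \<omega>)) N K"
    using converges_in_law_continuous_image[OF joint, of "\<lambda>p. fst (snd (snd p))"]
    by (simp add: continuous_intros)
  moreover have "converges_in_law M (\<lambda>n \<omega>. map_nao (\<lambda>\<delta>. - c2_hessian (q\<^sub>n n \<omega>) \<delta>) (\<delta>h n \<omega>)) N
      (\<lambda>\<omega>. Obj (K \<omega>))"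
    using converges_in_law_continuous_image[OF joint, of "\<lambda>p. fst (snd (snd (snd p)))"]
    by (simp add: continuous_intros)
  moreover have "converges_in_law M \<delta>h N (\<lambda>\<omega>. Obj (matrix_inv (K \<omega>) *v Z \<omega>))"
    using converges_in_law_continuous_image[OF joint, of "\<lambda>p. fst (snd (snd (snd (snd p))))"]
    by (simp add: continuous_intros)
  ultimately show ?thesis
    using joint Wm W_law by blast
qed

end
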